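(* Let $U$ be an $r$-dimensional subspace of $\mathbb{R}^d$ and let $y=x+v$ with $x\in U$ and $0\ne v\in U^\perp$. Fix $\delta\in(0,1)$ and an integer $m\ge\max\{\frac83 r\mu(U)\log(2d/\delta),\,4\mu(v)\log(1/\delta)\}$, and let $\Omega$ be a list of $m$ indices sampled independently and uniformly with replacement from $[d]$. Define $$\alpha=\sqrt{\frac{2\mu(v)}{m}\log(1/\delta)}+\frac{2\mu(v)}{3m}\log(1/\delta),\quad \beta=(1+2\log(1/\delta))^2,\quad \gamma=\sqrt{\frac{8r\mu(U)}{3m}\log(2d/\delta)},$$ and assume $\gamma<1$. Then with probability at least $1-4\delta$, $$\frac{m(1-\alpha)-r\mu(U)\frac{\beta}{1-\gamma}}{d}\|v\|_2^2\ \le\ \|y_\Omega-\mathcal{P}_{U_\Omega}y_\Omega\|_2^2\ \le\ (1+\alpha)\frac{m}{d}\|v\|_2^2.$$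
   Context: For an $r$-dimensional subspace $U\subseteq\mathbb{R}^d$, $\mu(U)=\frac{d}{r}\max_{i\in[d]}\|\mathcal{P}_Ue_i\|_2^2$; for a nonzero vector $v\in\mathbb{R}^d$, $\mu(v)=d\|v\|_\infty^2/\|v\|_2^2$. For a list $\Omega\in[d]^m$ and $z\in\mathbb{R}^d$, $z_\Omega\in\mathbb{R}^m$ has $j$th entry $z(\Omega(j))$. Taking $U$ also to denote a $d\times r$ matrix with orthonormal columns spanning $U$, $U_\Omega$ is the $m\times r$ matrix whose $j$th row is row $\Omega(j)$ of $U$, and $\mathcal{P}_{U_\Omega}$ is the orthogonal projection in $\mathbb{R}^m$ onto the column span of $U_\Omega$. *)

theory Defs
  imports "HOL-Analysis.Analysis" "HOL-Probability.Probability"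
begin

definition proj_onto :: "'a::euclidean_space set \<Rightarrow> 'a \<Rightarrow> 'a" where
  "proj_onto S x = (THE p. p \<in> S \<and> (\<forall>s\<in>S. (x - p) \<bullet> s = 0))"

definition std_basis :: "'d::finite \<Rightarrow> real^'d" where
  "std_basis i = axis i 1"

definition coh_subspace :: "(real^'d::finite) set \<Rightarrow> real" where
  "coh_subspace U = (real CARD('d) / real (dim U)) *
      (MAX i\<in>(UNIV::'d set). (norm (proj_onto U (std_basis i)))\<^sup>2)"

definition coh_vec :: "real^'d::finite \<Rightarrow> real" where
  "coh_vec v = real CARD('d) * (MAX i\<in>(UNIV::'d set). \<bar>v $ i\<bar>)\<^sup>2 / (norm v)\<^sup>2"

definition restr :: "('m::finite \<Rightarrow> 'd::finite) \<Rightarrow> real^'d \<Rightarrow> real^'m" where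
  "restr \<Omega> z = (\<chi> j. z $ \<Omega> j)"

text \<open>Column span of U_Omega, i.e. the image of U under restriction to Omega.\<close>
definition restr_subspace :: "('m::finite \<Rightarrow> 'd::finite) \<Rightarrow> (real^'d) set \<Rightarrow> (real^'m) set" where
  "restr_subspace \<Omega> U = restr \<Omega> ` U"

end

theory Submission
  imports Defs
begin

text \<open>
  Let \<open>a k\<close> be the projection of the \<open>k\<close>-th basis vector onto \<open>U\<close>. Since \<open>x\<^sub>\<Omega>\<close> lies in the column span,
  the residual energy is \<open>|v\<^sub>\<Omega>|\<^sup>2 - |P v\<^sub>\<Omega>|\<^sup>2\<close>, and \<open>|P v\<^sub>\<Omega>|\<^sup>2 \<le> |Z|\<^sup>2 / \<kappa>\<close>, where
  \<open>Z = \<Sum>\<^sub>j v (\<Omega> j) a (\<Omega> j)\<close> and \<open>\<kappa>\<close> is the least eigenvalue of \<open>\<Sum>\<^sub>j a (\<Omega> j) a (\<Omega> j)\<^sup>T\<close> on \<open>U\<close>. The energy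
  \<open>|v\<^sub>\<Omega>|\<^sup>2\<close> is controlled by scalar Bernstein bounds, and \<open>|Z|\<close>, a sum of mean-zero vectors, by
  the exponential moment of \<open>sqrt (1 + |Z|\<^sup>2)\<close>. For \<open>\<kappa>\<close> a matrix Chernoff bound is needed. It is
  obtained without matrix exponentials, from the moments \<open>E tr (P\<^sub>U - \<eta> S)\<^sup>N\<close> with \<open>\<eta> = \<theta> / N\<close> and
  \<open>N \<rightarrow> \<infinity>\<close>: each summand of \<open>S\<close> has rank one, so its effect on the trace of an \<open>N\<close>-th power is
  bounded to second order by a telescoping sum and the log-convexity of \<open>i \<mapsto> a \<bullet> M\<^sup>i a\<close>.
\<close>

section \<open>Exponential moments of sums of samples\<close>

text \<open>The potential \<open>\<Phi>\<close> sees only the multiset of samples, so summing over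
  one further sample costs a factor \<open>C\<close> and the coordinates can be peeled off one by
  one. The step is demanded only below \<open>card I\<close> samples because the trace potential
  used later is controlled only while the residual operator stays positive semidefinite.\<close>

lemma sum_UNIV_image_mset_le:
  fixes \<Phi> :: "'d::finite multiset \<Rightarrow> real"
  assumes "finite I" "0 \<le> C"
    and "\<And>A. size A < card I \<Longrightarrow> (\<Sum>k\<in>UNIV. \<Phi> (add_mset k A)) \<le> C * \<Phi> A"
  shows "(\<Sum>\<Omega>\<in>PiE I (\<lambda>_. UNIV). \<Phi> (image_mset \<Omega> (mset_set I))) \<le> C ^ card I * \<Phi> {#}"
  using assms(1,3)
proof (induction I rule: finite_induct)
  case empty
  then show ?case by simp
next
  case (insert i I)
  have inj: "inj_on (\<lambda>(y, g). g(i := y)) (UNIV \<times> (I \<rightarrow>\<^sub>E (UNIV::'d set)))"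
    using inj_combinator[of i I "\<lambda>_. UNIV"] insert.hyps by simp
  have eq: "image_mset (g(i := y)) (mset_set (insert i I)) = add_mset y (image_mset g (mset_set I))"
    for g :: "_ \<Rightarrow> 'd" and y
    using insert.hyps by (auto intro!: image_mset_cong)
  have "(\<Sum>\<Omega>\<in>PiE (insert i I) (\<lambda>_. UNIV). \<Phi> (image_mset \<Omega> (mset_set (insert i I))))
      = (\<Sum>(y, g)\<in>UNIV \<times> (I \<rightarrow>\<^sub>E UNIV). \<Phi> (add_mset y (image_mset g (mset_set I))))"
    unfolding PiE_insert_eq by (subst sum.reindex[OF inj]) (simp add: eq case_prod_unfold)
  also have "\<dots> = (\<Sum>g\<in>I \<rightarrow>\<^sub>E UNIV. \<Sum>y\<in>UNIV. \<Phi> (add_mset y (image_mset g (mset_set I))))"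
    by (subst sum.swap) (simp add: sum.cartesian_product)
  also have "\<dots> \<le> (\<Sum>g\<in>I \<rightarrow>\<^sub>E UNIV. C * \<Phi> (image_mset g (mset_set I)))"
    using insert.hyps by (intro sum_mono insert.prems) simp
  also have "\<dots> = C * (\<Sum>g\<in>I \<rightarrow>\<^sub>E UNIV. \<Phi> (image_mset g (mset_set I)))"
    by (simp add: sum_distrib_left)
  also have "\<dots> \<le> C * (C ^ card I * \<Phi> {#})"
    using insert.hyps by (intro mult_left_mono insert.IH insert.prems assms) auto
  finally show ?case using insert.hyps by simp
qed

abbreviation sample :: "('m::finite \<Rightarrow> 'd::finite) \<Rightarrow> 'd multiset" where
  "sample \<Omega> \<equiv> image_mset \<Omega> (mset_set UNIV)"

text \<open>Markov's inequality: \<open>c\<close> bounds the mean growth of \<open>\<Phi>\<close>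
  per sample, and \<open>\<tau>\<close> bounds \<open>\<Phi>\<close> from below on the bad event.
  The four tail bounds that follow are instances with different potentials.\<close>

lemma prob_sample_le:
  fixes \<Phi> :: "'d::finite multiset \<Rightarrow> real"
  assumes "0 \<le> c" "0 < \<tau>" "\<And>A. size A \<le> CARD('m) \<Longrightarrow> 0 \<le> \<Phi> A"
    and step: "\<And>A. size A < CARD('m::finite) \<Longrightarrow>
      (\<Sum>k\<in>UNIV. \<Phi> (add_mset k A)) \<le> real CARD('d) * c * \<Phi> A"
    and B: "\<And>\<Omega>. \<Omega> \<in> B \<Longrightarrow> \<tau> \<le> \<Phi> (sample \<Omega>)"
  shows "measure_pmf.prob (pmf_of_set (UNIV :: ('m \<Rightarrow> 'd) set)) B \<le> c ^ CARD('m) * \<Phi> {#} / \<tau>"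
proof -
  let ?D = "real CARD('d)" and ?m = "CARD('m)"
  have "real (card B) * \<tau> = (\<Sum>\<Omega>\<in>B. \<tau>)" by simp
  also have "\<dots> \<le> (\<Sum>\<Omega>\<in>B. \<Phi> (sample \<Omega>))"
    by (intro sum_mono B)
  also have "\<dots> \<le> (\<Sum>\<Omega>\<in>(UNIV :: ('m \<Rightarrow> 'd) set). \<Phi> (sample \<Omega>))"
    by (intro sum_mono2) (auto intro!: assms(3))
  also have "\<dots> \<le> (?D * c) ^ ?m * \<Phi> {#}"
    using sum_UNIV_image_mset_le[of "UNIV :: 'm set" "?D * c" \<Phi>] assms(1) step
    by (simp add: PiE_UNIV_domain)
  finally have "real (card B) \<le> (?D * c) ^ ?m * \<Phi> {#} / \<tau>"
    using assms(2) by (simp add: field_simps)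
  then have "real (card B) / ?D ^ ?m \<le> c ^ ?m * \<Phi> {#} / \<tau>"
    by (simp add: field_simps power_mult_distrib)
  then show ?thesis
    by (simp add: measure_pmf_of_set card_fun)
qed

section \<open>Bernstein bounds for bounded nonnegative scalars\<close>

text \<open>For nonnegative \<open>x\<close> the Taylor tail is dominated by a geometric series of
  ratio \<open>x / 3\<close>; for negative \<open>x\<close> the bound 1 + x + x^2/2 is enough. Only
  an upper bound on \<open>x\<close> enters, so \<open>b = 0\<close> serves for lower tails.\<close>

lemma exp_le_quadratic:
  fixes x b :: real
  assumes "x \<le> b" "0 \<le> b" "b < 3"
  shows "exp x \<le> 1 + x + x\<^sup>2 / (2 * (1 - b / 3))"
proof (cases "0 \<le> x")
  case True
  have exps: "(\<lambda>n. x ^ n / fact n) sums exp x"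
    using exp_converges[of x] by (simp add: scaleR_conv_of_real divide_inverse mult.commute)
  have s1: "(\<lambda>n. x ^ (n + 2) / fact (n + 2)) sums (exp x - (1 + x))"
    using sums_split_initial_segment[OF exps, of 2] by (simp add: numeral_2_eq_2)
  have s2: "(\<lambda>n. x\<^sup>2 / 2 * (x / 3) ^ n) sums (x\<^sup>2 / 2 * (1 / (1 - x / 3)))"
    using True assms by (intro sums_mult geometric_sums) auto
  have le: "x ^ (n + 2) / fact (n + 2) \<le> x\<^sup>2 / 2 * (x / 3) ^ n" for n
  proof -
    have "2 * 3 ^ n \<le> (fact (n + 2) :: real)"
    proof (induction n)
      case (Suc n)
      have "2 * 3 ^ Suc n \<le> 3 * (fact (n + 2) :: real)" using Suc unfolding power_Suc by linarith
      also have "\<dots> \<le> real (n + 3) * fact (n + 2)" by (intro mult_right_mono) auto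
      finally show ?case by (simp add: eval_nat_numeral mult_ac)
    qed simp
    then have "x ^ (n + 2) / fact (n + 2) \<le> x ^ (n + 2) / (2 * 3 ^ n)"
      using True by (intro divide_left_mono) auto
    then show ?thesis by (simp add: power_divide power_add field_simps power2_eq_square)
  qed
  have "exp x - (1 + x) \<le> x\<^sup>2 / 2 * (1 / (1 - x / 3))"
    by (rule sums_le[OF le s1 s2])
  also have "\<dots> = x\<^sup>2 / (2 * (1 - x / 3))" by simp
  also have "\<dots> \<le> x\<^sup>2 / (2 * (1 - b / 3))"
    using assms True by (intro divide_left_mono) (auto intro!: mult_pos_pos)
  finally show ?thesis by simp
next
  case False
  define f where "f = (\<lambda>t::real. 1 + t + t\<^sup>2 / 2 - exp t)"
  have "f 0 \<le> f x"
  proof (rule DERIV_nonpos_imp_nonincreasing[of x 0 f])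
    fix t :: real assume "x \<le> t" "t \<le> 0"
    have "(f has_real_derivative (1 + t - exp t)) (at t)"
      unfolding f_def by (auto intro!: derivative_eq_intros)
    then show "\<exists>y. (f has_real_derivative y) (at t) \<and> y \<le> 0"
      using exp_ge_add_one_self[of t] by (auto intro!: exI[of _ "1 + t - exp t"])
  qed (use False in simp)
  then have "exp x \<le> 1 + x + x\<^sup>2 / 2" by (simp add: f_def)
  also have "x\<^sup>2 / 2 \<le> x\<^sup>2 / (2 * (1 - b / 3))"
    using assms by (intro divide_left_mono) auto
  finally show ?thesis by simp
qed

text \<open>Chernoff's method. Since 0 \<le> Y \<le> M, the second moment is at most
  \<open>M * \<mu>\<close>, so the exponent depends on \<open>\<mu>\<close> and \<open>M\<close>
  only through their ratio.\<close>

lemma prob_sum_ge: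
  fixes Y :: "'d::finite \<Rightarrow> real"
  assumes "\<And>k. 0 \<le> Y k" "\<And>k. Y k \<le> M" "(\<Sum>k\<in>UNIV. Y k) = real CARD('d) * \<mu>" "0 < \<mu>" "0 < \<alpha>"
  shows "measure_pmf.prob (pmf_of_set (UNIV :: ('m::finite \<Rightarrow> 'd) set))
      {\<Omega>. (1 + \<alpha>) * real CARD('m) * \<mu> \<le> (\<Sum>j\<in>UNIV. Y (\<Omega> j))}
    \<le> exp (- real CARD('m) * (\<mu> / M) * \<alpha>\<^sup>2 / (2 * (1 + \<alpha> / 3)))"
proof -
  let ?D = "real CARD('d)" and ?m = "real CARD('m)"
  have M: "0 < M"
  proof (rule ccontr)
    assume "\<not> 0 < M"
    then have "(\<Sum>k\<in>UNIV. Y k) \<le> (\<Sum>k\<in>(UNIV::'d set). 0)"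
      using assms(2) by (intro sum_mono) (meson linorder_not_less order_trans)
    moreover have "0 < ?D * \<mu>" using assms(4) by simp
    ultimately show False using assms(3) by simp
  qed
  \<comment> \<open>The Bernstein choice of the scaled parameter: \<open>1 - s / 3\<close> becomes
    \<open>1 / (1 + \<alpha> / 3)\<close>, and the quadratic cost \<open>q * s^2\<close> is then
    exactly half of the gain \<open>s * \<alpha>\<close>.\<close>
  define s where "s = \<alpha> / (1 + \<alpha> / 3)"
  have s: "0 < s" "s < 3" "1 - s / 3 = 1 / (1 + \<alpha> / 3)"
    using assms(5) by (auto simp: s_def field_simps)
  define l where "l = s / M"
  have l: "0 < l" using s M by (simp add: l_def)
  define q where "q = 1 / (2 * (1 - s / 3))"
  have q: "0 \<le> q" using s(2) by (simp add: q_def)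
  define \<epsilon> where "\<epsilon> = l * \<mu> + q * l * s * \<mu>"
  have pt: "exp (l * Y k) \<le> 1 + l * Y k + q * l * s * Y k" for k
  proof -
    have le: "l * Y k \<le> s" using assms(2)[of k] M s by (simp add: l_def field_simps)
    have "exp (l * Y k) \<le> 1 + l * Y k + q * (l * Y k)\<^sup>2"
      using exp_le_quadratic[OF le] s(1,2) by (simp add: q_def)
    moreover have "(l * Y k)\<^sup>2 \<le> s * (l * Y k)"
      unfolding power2_eq_square using le l assms(1)[of k] by (intro mult_right_mono) auto
    then have "q * (l * Y k)\<^sup>2 \<le> q * (s * (l * Y k))" using q by (rule mult_left_mono)
    ultimately show ?thesis by (simp add: mult_ac)
  qed
  have "(\<Sum>k\<in>UNIV. exp (l * Y k)) \<le> (\<Sum>k\<in>UNIV. 1 + l * Y k + q * l * s * Y k)"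
    by (intro sum_mono pt)
  also have "\<dots> = ?D * (1 + \<epsilon>)"
    by (simp add: sum.distrib sum_distrib_left[symmetric] assms(3) \<epsilon>_def algebra_simps)
  also have "\<dots> \<le> ?D * exp \<epsilon>"
    by (intro mult_left_mono) (simp_all add: exp_ge_add_one_self)
  finally have avg: "(\<Sum>k\<in>UNIV. exp (l * Y k)) \<le> ?D * exp \<epsilon>" .
  have "measure_pmf.prob (pmf_of_set (UNIV :: ('m \<Rightarrow> 'd) set))
      {\<Omega>. (1 + \<alpha>) * ?m * \<mu> \<le> (\<Sum>j\<in>UNIV. Y (\<Omega> j))}
     \<le> exp \<epsilon> ^ CARD('m) * (\<lambda>A. exp (l * (\<Sum>k\<in>#A. Y k))) {#} / exp (l * ((1 + \<alpha>) * ?m * \<mu>))"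
  proof (rule prob_sample_le)
    fix A :: "'d multiset"
    have "(\<Sum>k\<in>UNIV. exp (l * (\<Sum>k\<in>#add_mset k A. Y k)))
        = (\<Sum>k\<in>UNIV. exp (l * Y k)) * exp (l * (\<Sum>k\<in>#A. Y k))"
      by (simp add: distrib_left exp_add sum_distrib_right)
    also have "\<dots> \<le> ?D * exp \<epsilon> * exp (l * (\<Sum>k\<in>#A. Y k))"
      by (intro mult_right_mono avg) auto
    finally show "(\<Sum>k\<in>UNIV. exp (l * (\<Sum>k\<in>#add_mset k A. Y k))) \<le> \<dots>" .
  next
    fix \<Omega> :: "'m \<Rightarrow> 'd" assume "\<Omega> \<in> {\<Omega>. (1 + \<alpha>) * ?m * \<mu> \<le> (\<Sum>j\<in>UNIV. Y (\<Omega> j))}"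
    then show "exp (l * ((1 + \<alpha>) * ?m * \<mu>)) \<le> exp (l * (\<Sum>k\<in>#sample \<Omega>. Y k))"
      using l by (simp add: sum_unfold_sum_mset multiset.map_comp o_def)
  qed auto
  also have "\<dots> = exp (?m * \<epsilon> - l * ((1 + \<alpha>) * ?m * \<mu>))"
    by (simp add: exp_diff exp_of_nat_mult)
  also have "?m * \<epsilon> - l * ((1 + \<alpha>) * ?m * \<mu>) = ?m * (\<mu> / M) * (q * s\<^sup>2 - s * \<alpha>)"
    using M by (simp add: \<epsilon>_def l_def field_simps power2_eq_square)
  also have "q * s\<^sup>2 - s * \<alpha> = - (\<alpha>\<^sup>2 / (2 * (1 + \<alpha> / 3)))"
    using assms(5) unfolding q_def s(3) unfolding s_def
    by (simp add: divide_simps power2_eq_square)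
  finally show ?thesis by simp
qed

text \<open>The exponents \<open>- (l * Y k)\<close> are nonpositive, so the quadratic bound holds
  with \<open>b = 0\<close> and the lower tail has no Bernstein denominator;
  \<open>l = \<alpha> / M\<close> minimises the resulting exponent.\<close>

lemma prob_sum_le:
  fixes Y :: "'d::finite \<Rightarrow> real"
  assumes "\<And>k. 0 \<le> Y k" "\<And>k. Y k \<le> M" "(\<Sum>k\<in>UNIV. Y k) = real CARD('d) * \<mu>" "0 < M" "0 < \<alpha>"
  shows "measure_pmf.prob (pmf_of_set (UNIV :: ('m::finite \<Rightarrow> 'd) set))
      {\<Omega>. (\<Sum>j\<in>UNIV. Y (\<Omega> j)) \<le> (1 - \<alpha>) * real CARD('m) * \<mu>}
    \<le> exp (- real CARD('m) * (\<mu> / M) * \<alpha>\<^sup>2 / 2)"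
proof -
  let ?D = "real CARD('d)" and ?m = "real CARD('m)"
  define l where "l = \<alpha> / M"
  have l: "0 < l" using assms by (simp add: l_def)
  define \<epsilon> where "\<epsilon> = - l * \<mu> + l * \<alpha> * \<mu> / 2"
  have pt: "exp (- (l * Y k)) \<le> 1 + - (l * Y k) + l * \<alpha> * Y k / 2" for k
  proof -
    have le: "l * Y k \<le> \<alpha>" using assms(2)[of k] assms(4,5) by (simp add: l_def field_simps)
    have "exp (- (l * Y k)) \<le> 1 + - (l * Y k) + (l * Y k)\<^sup>2 / 2"
      using exp_le_quadratic[of "- (l * Y k)" 0] l assms(1)[of k] by simp
    moreover have "(l * Y k)\<^sup>2 \<le> \<alpha> * (l * Y k)"
      unfolding power2_eq_square using le l assms(1)[of k] by (intro mult_right_mono) auto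
    ultimately show ?thesis by (simp add: mult_ac)
  qed
  have "(\<Sum>k\<in>UNIV. exp (- (l * Y k))) \<le> (\<Sum>k\<in>UNIV. 1 + - (l * Y k) + l * \<alpha> * Y k / 2)"
    by (intro sum_mono pt)
  also have "\<dots> = ?D * (1 + \<epsilon>)"
    by (simp add: sum.distrib sum_distrib_left[symmetric] sum_divide_distrib[symmetric] sum_negf
        sum_subtractf assms(3) \<epsilon>_def algebra_simps)
  also have "\<dots> \<le> ?D * exp \<epsilon>"
    by (intro mult_left_mono) (simp_all add: exp_ge_add_one_self)
  finally have avg: "(\<Sum>k\<in>UNIV. exp (- (l * Y k))) \<le> ?D * exp \<epsilon>" .
  have "measure_pmf.prob (pmf_of_set (UNIV :: ('m \<Rightarrow> 'd) set))
      {\<Omega>. (\<Sum>j\<in>UNIV. Y (\<Omega> j)) \<le> (1 - \<alpha>) * ?m * \<mu>}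
     \<le> exp \<epsilon> ^ CARD('m) * (\<lambda>A. exp (- (l * (\<Sum>k\<in>#A. Y k)))) {#} / exp (- (l * ((1 - \<alpha>) * ?m * \<mu>)))"
  proof (rule prob_sample_le)
    fix A :: "'d multiset"
    have "(\<Sum>k\<in>UNIV. exp (- (l * (\<Sum>k\<in>#add_mset k A. Y k))))
        = (\<Sum>k\<in>UNIV. exp (- (l * Y k))) * exp (- (l * (\<Sum>k\<in>#A. Y k)))"
      by (simp add: distrib_left exp_add[symmetric] sum_distrib_right)
    also have "\<dots> \<le> ?D * exp \<epsilon> * exp (- (l * (\<Sum>k\<in>#A. Y k)))"
      by (intro mult_right_mono avg) auto
    finally show "(\<Sum>k\<in>UNIV. exp (- (l * (\<Sum>k\<in>#add_mset k A. Y k)))) \<le> \<dots>" .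
  next
    fix \<Omega> :: "'m \<Rightarrow> 'd" assume "\<Omega> \<in> {\<Omega>. (\<Sum>j\<in>UNIV. Y (\<Omega> j)) \<le> (1 - \<alpha>) * ?m * \<mu>}"
    then show "exp (- (l * ((1 - \<alpha>) * ?m * \<mu>))) \<le> exp (- (l * (\<Sum>k\<in>#sample \<Omega>. Y k)))"
      using l by (simp add: sum_unfold_sum_mset multiset.map_comp o_def)
  qed auto
  also have "\<dots> = exp (?m * \<epsilon> + l * ((1 - \<alpha>) * ?m * \<mu>))"
    by (simp add: exp_add exp_of_nat_mult exp_minus divide_inverse)
  also have "?m * \<epsilon> + l * ((1 - \<alpha>) * ?m * \<mu>) = - ?m * (\<mu> / M) * \<alpha>\<^sup>2 / 2"
    using assms(4) by (simp add: \<epsilon>_def l_def field_simps power2_eq_square)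
  finally show ?thesis .
qed

text \<open>A dimension-free exponential moment: \<open>sqrt (1 + |x|\<^sup>2)\<close> is a smooth substitute for \<open>|x|\<close>, and
  concavity of the square root makes its increment linear in the mean-zero step up to \<open>|y|\<^sup>2\<close>.\<close>

lemma exp_sqrt_norm_step:
  fixes x y :: "'a::real_inner"
  assumes "(norm y)\<^sup>2 \<le> 1 / 4"
  defines "\<psi> \<equiv> sqrt (1 + (norm x)\<^sup>2)"
  shows "exp (sqrt (1 + (norm (x + y))\<^sup>2)) \<le> exp \<psi> * (1 + (x \<bullet> y) / \<psi> + 7 / 6 * (norm y)\<^sup>2)"
proof -
  define h where "h = norm y"
  \<comment> \<open>\<open>\<psi> + z\<close> is the tangent line of the square root at
    \<open>\<psi>^2\<close>, evaluated at 1 + |x + y|^2.\<close>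
  define z where "z = (x \<bullet> y + h\<^sup>2 / 2) / \<psi>"
  have psi2: "\<psi>\<^sup>2 = 1 + (norm x)\<^sup>2" by (simp add: \<psi>_def)
  have psi1: "1 \<le> \<psi>" by (simp add: \<psi>_def)
  have h: "0 \<le> h" "h\<^sup>2 \<le> 1 / 4" using assms by (auto simp: h_def)
  have "sqrt (1 + (norm (x + y))\<^sup>2) \<le> \<psi> + z"
  proof (rule real_le_lsqrt)
    have nxy: "(norm (x + y))\<^sup>2 = (norm x)\<^sup>2 + 2 * (x \<bullet> y) + h\<^sup>2"
      by (simp add: power2_norm_eq_inner inner_simps inner_commute h_def)
    have zp: "z * \<psi> = x \<bullet> y + h\<^sup>2 / 2" using psi1 by (simp add: z_def)
    have "(\<psi> + z)\<^sup>2 = \<psi>\<^sup>2 + 2 * (z * \<psi>) + z\<^sup>2" by (simp add: power2_eq_square algebra_simps)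
    then have eq: "(\<psi> + z)\<^sup>2 = 1 + (norm (x + y))\<^sup>2 + z\<^sup>2" by (simp add: psi2 zp nxy)
    then show "1 + (norm (x + y))\<^sup>2 \<le> (\<psi> + z)\<^sup>2" by simp
    have "0 \<le> \<psi>\<^sup>2 + z * \<psi>"
      using zero_le_power2[of "norm (x + y)"] zero_le_power2[of "norm x"]
      unfolding psi2 zp nxy by linarith
    then have "0 \<le> \<psi> * (\<psi> + z)" by (simp add: power2_eq_square algebra_simps)
    then show "0 \<le> \<psi> + z" using psi1 by (simp add: zero_le_mult_iff)
  qed
  then have "exp (sqrt (1 + (norm (x + y))\<^sup>2)) \<le> exp \<psi> * exp z"
    by (simp add: exp_add[symmetric])
  also have "exp z \<le> 1 + (x \<bullet> y) / \<psi> + 7 / 6 * h\<^sup>2"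
  proof -
    have "\<bar>x \<bullet> y + h\<^sup>2 / 2\<bar> \<le> norm x * h + h\<^sup>2 / 2"
      using Cauchy_Schwarz_ineq2[of x y] zero_le_power2[of h] unfolding h_def by linarith
    also have "\<dots> = h * (norm x + h / 2)" by (simp add: power2_eq_square algebra_simps)
    finally have "(x \<bullet> y + h\<^sup>2 / 2)\<^sup>2 \<le> (h * (norm x + h / 2))\<^sup>2"
      by (rule power2_le_iff_abs_le[THEN iffD2, rotated]) (use h in auto)
    also have "\<dots> = h\<^sup>2 * (norm x + h / 2)\<^sup>2" by (simp add: power_mult_distrib)
    also have "\<dots> \<le> h\<^sup>2 * (17 / 16 * \<psi>\<^sup>2)"
    proof (intro mult_left_mono)
      \<comment> \<open>Cauchy-Schwarz for the pairs (|x|, 1) and (1, h/2).\<close>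
      have "(norm x + h / 2)\<^sup>2 \<le> (1 + h\<^sup>2 / 4) * \<psi>\<^sup>2"
        unfolding psi2 using zero_le_power2[of "1 - norm x * h / 2"]
        by (simp add: power2_eq_square field_simps)
      also have "\<dots> \<le> 17 / 16 * \<psi>\<^sup>2" using h by (intro mult_right_mono) auto
      finally show "(norm x + h / 2)\<^sup>2 \<le> 17 / 16 * \<psi>\<^sup>2" .
    qed simp
    finally have "(x \<bullet> y + h\<^sup>2 / 2)\<^sup>2 \<le> 17 / 16 * h\<^sup>2 * \<psi>\<^sup>2"
      by (simp add: mult_ac)
    then have z2: "z\<^sup>2 \<le> 17 / 16 * h\<^sup>2"
      using psi1 by (simp add: z_def power_divide divide_le_eq)
    then have "z\<^sup>2 \<le> (3 / 5)\<^sup>2" using h by (simp add: power2_eq_square)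
    then have "z \<le> 3 / 5" by (rule power2_le_imp_le) simp
    \<comment> \<open>With \<open>b = 3 / 5\<close> the factor 1/(2 (1 - b/3)) is 5/8. Then 5/8 *
      17/16 = 85/128 is below 2/3, and the 1/2 contributed by \<open>z\<close> itself completes
      7/6.\<close>
    from exp_le_quadratic[OF this] have "exp z \<le> 1 + z + 5 / 8 * z\<^sup>2" by simp
    also have "5 / 8 * z\<^sup>2 \<le> 2 / 3 * h\<^sup>2" using z2 zero_le_power2[of h] by linarith
    also have "z \<le> (x \<bullet> y) / \<psi> + h\<^sup>2 / 2"
    proof -
      have "h\<^sup>2 / 2 / \<psi> \<le> h\<^sup>2 / 2" using psi1 mult_left_mono[OF psi1, of "h\<^sup>2"]
        by (simp add: divide_le_eq)
      then show ?thesis by (simp add: z_def add_divide_distrib)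
    qed
    finally show ?thesis by simp
  qed
  finally show ?thesis by (simp add: h_def)
qed

text \<open>The mean-zero assumption kills the linear term of \<open>exp_sqrt_norm_step\<close>,
  whatever the current sum is. The m samples then contribute 7/6 to the exponent and the empty sum
  contributes sqrt 1 = 1, which gives 13/6.\<close>

lemma prob_norm_sum_ge:
  fixes Y :: "'d::finite \<Rightarrow> 'a::real_inner"
  assumes "(\<Sum>k\<in>UNIV. Y k) = 0" "\<And>k. (norm (Y k))\<^sup>2 \<le> 1 / 4"
    and "(\<Sum>k\<in>UNIV. (norm (Y k))\<^sup>2) \<le> real CARD('d) / real CARD('m::finite)"
  shows "measure_pmf.prob (pmf_of_set (UNIV :: ('m \<Rightarrow> 'd) set))
      {\<Omega>. t \<le> norm (\<Sum>j\<in>UNIV. Y (\<Omega> j))} \<le> exp (13 / 6 - t)"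
proof -
  let ?D = "real CARD('d)" and ?m = "real CARD('m)"
  let ?\<Phi> = "\<lambda>A. exp (sqrt (1 + (norm (\<Sum>k\<in>#A. Y k))\<^sup>2))"
  define c where "c = exp (7 / 6 / ?m)"
  have "measure_pmf.prob (pmf_of_set (UNIV :: ('m \<Rightarrow> 'd) set))
      {\<Omega>. t \<le> norm (\<Sum>j\<in>UNIV. Y (\<Omega> j))} \<le> c ^ CARD('m) * ?\<Phi> {#} / exp t"
  proof (rule prob_sample_le)
    fix A :: "'d multiset"
    define x where "x = (\<Sum>k\<in>#A. Y k)"
    define \<psi> where "\<psi> = sqrt (1 + (norm x)\<^sup>2)"
    have "(\<Sum>k\<in>UNIV. ?\<Phi> (add_mset k A)) = (\<Sum>k\<in>UNIV. exp (sqrt (1 + (norm (x + Y k))\<^sup>2)))"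
      by (simp add: x_def add.commute)
    also have "\<dots> \<le> (\<Sum>k\<in>UNIV. exp \<psi> * (1 + (x \<bullet> Y k) / \<psi> + 7 / 6 * (norm (Y k))\<^sup>2))"
      unfolding \<psi>_def by (intro sum_mono exp_sqrt_norm_step assms)
    also have "\<dots> = exp \<psi> * (?D + (x \<bullet> (\<Sum>k\<in>UNIV. Y k)) / \<psi> + 7 / 6 * (\<Sum>k\<in>UNIV. (norm (Y k))\<^sup>2))"
      by (simp add: sum.distrib sum_distrib_left[symmetric] sum_divide_distrib[symmetric]
          inner_sum_right[symmetric])
    also have "\<dots> \<le> exp \<psi> * (?D + 7 / 6 * (?D / ?m))"
      using assms(1,3) by (intro mult_left_mono) auto
    also have "\<dots> = ?D * (1 + 7 / 6 / ?m) * exp \<psi>" by (simp add: field_simps)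
    also have "\<dots> \<le> ?D * c * exp \<psi>"
      unfolding c_def by (intro mult_right_mono mult_left_mono exp_ge_add_one_self) auto
    finally show "(\<Sum>k\<in>UNIV. ?\<Phi> (add_mset k A)) \<le> ?D * c * ?\<Phi> A"
      by (simp add: \<psi>_def x_def)
  next
    fix \<Omega> :: "'m \<Rightarrow> 'd" assume "\<Omega> \<in> {\<Omega>. t \<le> norm (\<Sum>j\<in>UNIV. Y (\<Omega> j))}"
    then have "t \<le> norm (\<Sum>j\<in>UNIV. Y (\<Omega> j))" by simp
    also have "\<dots> \<le> sqrt (1 + (norm (\<Sum>j\<in>UNIV. Y (\<Omega> j)))\<^sup>2)"
      by (rule real_le_rsqrt) simp
    finally show "exp t \<le> ?\<Phi> (sample \<Omega>)"
      by (simp add: sum_unfold_sum_mset multiset.map_comp o_def)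
  qed (auto simp: c_def)
  also have "\<dots> = exp (13 / 6 - t)"
    by (simp add: c_def exp_of_nat_mult[symmetric] exp_add[symmetric] exp_diff)
  finally show ?thesis .
qed

section \<open>Trace powers under rank-one downdates\<close>

text \<open>Consecutive ratios of a log-convex sequence increase, so moving one unit from the
  smaller index to the larger one cannot lower the product. \<open>step\<close> is one such move,
  with vanishing terms treated apart.\<close>

lemma log_convex_mult_le:
  fixes f :: "nat \<Rightarrow> real"
  assumes nonneg: "\<And>i. 0 \<le> f i" and lc: "\<And>i. (f (Suc i))\<^sup>2 \<le> f i * f (Suc (Suc i))"
  shows "f p * f q \<le> f 0 * f (p + q)"
proof -
  have step: "f (Suc i) * f j \<le> f i * f (Suc j)" if "i \<le> j" for i j
    using that
  proof (induction j rule: dec_induct)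
    case (step j)
    show ?case
    proof (cases "f j = 0")
      case True
      then have "f (Suc j) = 0" using lc[of j] by simp
      then show ?thesis using nonneg by simp
    next
      case False
      then have pos: "0 < f j" using nonneg[of j] by simp
      have "f j * (f (Suc i) * f (Suc j)) = (f (Suc i) * f j) * f (Suc j)" by simp
      also have "\<dots> \<le> f i * f (Suc j) * f (Suc j)"
        using step nonneg by (intro mult_right_mono) auto
      also have "\<dots> = f i * (f (Suc j))\<^sup>2" by (simp add: power2_eq_square)
      also have "\<dots> \<le> f i * (f j * f (Suc (Suc j)))"
        using lc nonneg by (intro mult_left_mono) auto
      finally have "f j * (f (Suc i) * f (Suc j)) \<le> f j * (f i * f (Suc (Suc j)))"
        by (simp add: mult_ac)
      then show ?thesis using pos by simp
    qed
  qed simp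
  have "f p * f q \<le> f 0 * f (p + q)" if "p \<le> q" for p q
    using that
  proof (induction p arbitrary: q)
    case (Suc p)
    have "f (Suc p) * f q \<le> f p * f (Suc q)" using Suc.prems by (intro step) simp
    also have "\<dots> \<le> f 0 * f (p + Suc q)" using Suc.prems by (intro Suc.IH) simp
    finally show ?case by simp
  qed simp
  from this[of p q] this[of q p] show ?thesis
    by (cases "p \<le> q") (simp_all add: add.commute mult.commute)
qed

section \<open>Moments of positive semidefinite operators\<close>

text \<open>The operator acts on the whole space so that its trace can be taken over
  \<open>Basis\<close>; symmetry and \<open>range_M\<close> together force it to vanish on the
  orthogonal complement of \<open>U\<close>.\<close>

locale psd_operator =
  fixes U :: "'a::euclidean_space set" and M :: "'a \<Rightarrow> 'a"
  assumes subspace_U: "subspace U" and linear_M: "linear M"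
    and sym: "\<And>x y. M x \<bullet> y = x \<bullet> M y"
    and range_M: "\<And>x. M x \<in> U"
    and psd: "\<And>x. x \<in> U \<Longrightarrow> 0 \<le> x \<bullet> M x"
begin

lemma linear_pow: "linear (M ^^ n)"
proof (induction n)
  case 0
  then show ?case by (simp add: id_def linear_id[unfolded id_def])
next
  case (Suc n)
  then show ?case unfolding funpow.simps by (rule linear_compose[OF _ linear_M])
qed

lemma pow_in: "x \<in> U \<Longrightarrow> (M ^^ n) x \<in> U"
  by (cases n) (auto simp: range_M)

lemma pow_in': "0 < n \<Longrightarrow> (M ^^ n) x \<in> U"
  by (cases n) (auto simp: range_M)

lemma pow_inner: "(M ^^ i) x \<bullet> (M ^^ j) y = x \<bullet> (M ^^ (i + j)) y"
proof (induction i arbitrary: j)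
  case (Suc i)
  have "(M ^^ Suc i) x \<bullet> (M ^^ j) y = (M ^^ i) x \<bullet> (M ^^ Suc j) y" by (simp add: sym)
  then show ?case using Suc[of "Suc j"] by simp
qed simp

lemma pow_sym: "(M ^^ i) x \<bullet> y = x \<bullet> (M ^^ i) y"
  using pow_inner[of i x 0 y] by simp

lemma cauchy_schwarz:
  assumes "x \<in> U" "y \<in> U"
  shows "(x \<bullet> M y)\<^sup>2 \<le> (x \<bullet> M x) * (y \<bullet> M y)"
proof -
  define A B C where "A = x \<bullet> M x" and "B = x \<bullet> M y" and "C = y \<bullet> M y"
  have form: "0 \<le> s\<^sup>2 * A + 2 * s * t * B + t\<^sup>2 * C" for s t
  proof -
    have "y \<bullet> M x = B" using sym[of x y] by (simp add: B_def inner_commute)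
    then have "(s *\<^sub>R x + t *\<^sub>R y) \<bullet> M (s *\<^sub>R x + t *\<^sub>R y) = s\<^sup>2 * A + 2 * s * t * B + t\<^sup>2 * C"
      by (simp add: linear_add[OF linear_M] linear_cmul[OF linear_M] inner_simps A_def B_def C_def
          power2_eq_square algebra_simps)
    moreover have "s *\<^sub>R x + t *\<^sub>R y \<in> U"
      using assms subspace_U by (simp add: subspace_add subspace_scale)
    ultimately show ?thesis using psd by metis
  qed
  have nn: "0 \<le> A" "0 \<le> C" using psd assms by (auto simp: A_def C_def)
  \<comment> \<open>The form is tested at (C, -B) and at (-B, A). If both A and C vanish these say
    nothing, and (1, 1) and (1, -1) give B = 0.\<close>
  have "0 \<le> C * (A * C - B\<^sup>2)" using form[of C "- B"] by (simp add: power2_eq_square algebra_simps)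
  moreover have "0 \<le> A * (A * C - B\<^sup>2)" using form[of "- B" A] by (simp add: power2_eq_square algebra_simps)
  moreover have "B = 0" if "A = 0" "C = 0" using form[of 1 1] form[of 1 "-1"] that by simp
  ultimately have "B\<^sup>2 \<le> A * C"
    using nn by (cases "A = 0"; cases "C = 0") (auto simp: zero_le_mult_iff mult_le_0_iff)
  then show ?thesis by (simp add: A_def B_def C_def)
qed

definition moment :: "'a \<Rightarrow> nat \<Rightarrow> real" where
  "moment x i = x \<bullet> (M ^^ i) x"

lemma moment_even: "moment x (i + i) = (norm ((M ^^ i) x))\<^sup>2"
  by (simp add: moment_def power2_norm_eq_inner pow_inner)

lemma moment_odd: "moment x (Suc (i + i)) = (M ^^ i) x \<bullet> M ((M ^^ i) x)"
  using pow_inner[of i x "Suc i" x] by (simp add: moment_def)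

lemma moment_nonneg:
  assumes "x \<in> U" shows "0 \<le> moment x i"
proof (cases "even i")
  case True
  then obtain k where "i = k + k" by (auto elim!: evenE simp: mult_2)
  then show ?thesis by (simp add: moment_even)
next
  case False
  then obtain k where "i = Suc (k + k)" by (auto elim!: oddE simp: mult_2)
  then show ?thesis using psd[OF pow_in[OF assms]] by (simp add: moment_odd)
qed

text \<open>Around an even index this is Cauchy-Schwarz for the inner product, around an odd one for
  the semidefinite form of \<open>M\<close>; so no square root of \<open>M\<close> is
  required.\<close>

lemma moment_log_convex:
  assumes "x \<in> U" shows "(moment x (Suc i))\<^sup>2 \<le> moment x i * moment x (Suc (Suc i))"
proof (cases "even i")
  case True
  then obtain k where k: "i = k + k" by (auto elim!: evenE simp: mult_2)
  have "((M ^^ k) x \<bullet> (M ^^ Suc k) x)\<^sup>2 \<le> ((M ^^ k) x \<bullet> (M ^^ k) x) * ((M ^^ Suc k) x \<bullet> (M ^^ Suc k) x)"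
    by (rule Cauchy_Schwarz_ineq)
  then show ?thesis unfolding pow_inner moment_def k by simp
next
  case False
  then obtain k where k: "i = Suc (k + k)" by (auto elim!: oddE simp: mult_2)
  have "((M ^^ k) x \<bullet> M ((M ^^ Suc k) x))\<^sup>2
      \<le> ((M ^^ k) x \<bullet> M ((M ^^ k) x)) * ((M ^^ Suc k) x \<bullet> M ((M ^^ Suc k) x))"
    by (intro cauchy_schwarz pow_in assms)
  moreover have "(M ^^ k) x \<bullet> M ((M ^^ Suc k) x) = moment x (Suc i)"
    using pow_inner[of k x "Suc (Suc k)" x] by (simp add: moment_def k)
  moreover have "(M ^^ k) x \<bullet> M ((M ^^ k) x) = moment x i"
    using pow_inner[of k x "Suc k" x] by (simp add: moment_def k)
  moreover have "(M ^^ Suc k) x \<bullet> M ((M ^^ Suc k) x) = moment x (Suc (Suc i))"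
    using pow_inner[of "Suc k" x "Suc (Suc k)" x] by (simp add: moment_def k)
  ultimately show ?thesis by simp
qed

lemma moment_mult_le:
  assumes "x \<in> U" shows "moment x p * moment x q \<le> (norm x)\<^sup>2 * moment x (p + q)"
  using log_convex_mult_le[of "moment x" p q] moment_nonneg[OF assms] moment_log_convex[OF assms]
  by (simp add: moment_even[of x 0, simplified])

text \<open>Jensen's inequality for the spectral measure of \<open>M\<close> at \<open>x\<close>,
  obtained from log-convexity instead of a spectral decomposition.\<close>

lemma moment_ge_power:
  assumes "x \<in> U" "norm x = 1" shows "(x \<bullet> M x) ^ i \<le> moment x i"
proof (induction i)
  case 0
  then show ?case using moment_even[of x 0] assms by simp
next
  case (Suc i)
  have "(x \<bullet> M x) ^ Suc i \<le> moment x 1 * moment x i"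
    using Suc psd[OF assms(1)] by (simp add: moment_def mult_left_mono)
  also have "\<dots> \<le> moment x (Suc i)" using moment_mult_le[OF assms(1), of 1 i] assms(2) by simp
  finally show ?case .
qed

end

definition op_trace :: "('a::euclidean_space \<Rightarrow> 'a) \<Rightarrow> real" where
  "op_trace f = (\<Sum>b\<in>Basis. b \<bullet> f b)"

text \<open>Both operators are assumed semidefinite, so that the moments of \<open>a\<close> under
  either one are nonnegative; for the second this limits the size of \<eta>.\<close>

locale rank_one_downdate = M: psd_operator U M + X: psd_operator U "\<lambda>w. M w - (\<eta> * (a \<bullet> w)) *\<^sub>R a"
  for U :: "'a::euclidean_space set" and M \<eta> a +
  assumes a_in: "a \<in> U" and eta: "0 \<le> \<eta>"
begin

abbreviation X :: "'a \<Rightarrow> 'a" where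
  "X \<equiv> \<lambda>w. M w - (\<eta> * (a \<bullet> w)) *\<^sub>R a"

text \<open>The telescoping sum of M^i (M - X) X^(n-1-i), where M - X is \<eta> times the rank-one
  operator of \<open>a\<close>.\<close>

lemma pow_diff:
  "(M ^^ n) w - (X ^^ n) w = (\<Sum>i<n. (\<eta> * (a \<bullet> (X ^^ (n - Suc i)) w)) *\<^sub>R (M ^^ i) a)"
proof (induction n)
  case (Suc n)
  have "(M ^^ Suc n) w - (X ^^ Suc n) w
      = M ((M ^^ n) w - (X ^^ n) w) + (\<eta> * (a \<bullet> (X ^^ n) w)) *\<^sub>R a"
    by (simp add: linear_diff[OF M.linear_M])
  also have "M ((M ^^ n) w - (X ^^ n) w)
      = (\<Sum>i<n. (\<eta> * (a \<bullet> (X ^^ (n - Suc i)) w)) *\<^sub>R (M ^^ Suc i) a)"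
    unfolding Suc by (simp add: linear_sum[OF M.linear_M] linear_cmul[OF M.linear_M])
  finally show ?case by (simp add: sum.lessThan_Suc_shift add.commute del: sum.lessThan_Suc)
qed simp

lemma pow_diff_inner:
  "y \<bullet> (M ^^ n) w - y \<bullet> (X ^^ n) w
    = \<eta> * (\<Sum>i<n. (a \<bullet> (X ^^ (n - Suc i)) w) * (y \<bullet> (M ^^ i) a))"
  using arg_cong[OF pow_diff[of n w], of "\<lambda>v. y \<bullet> v"]
  by (simp add: inner_diff_right inner_sum_right sum_distrib_left mult_ac)

lemma moment_le: "X.moment a n \<le> M.moment a n"
proof -
  have "0 \<le> \<eta> * (\<Sum>i<n. X.moment a (n - Suc i) * M.moment a i)"
    using eta X.moment_nonneg[OF a_in] M.moment_nonneg[OF a_in]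
    by (intro mult_nonneg_nonneg sum_nonneg) auto
  then show ?thesis using pow_diff_inner[of a n a] by (simp add: M.moment_def X.moment_def)
qed

text \<open>In each of the \<open>l\<close> telescoping terms the moment under \<open>X\<close> is
  raised to one under \<open>M\<close>, and log-convexity merges the product of two moments into a
  single one.\<close>

lemma mixed_moment_ge:
  "M.moment a (k + l) - \<eta> * l * (norm a)\<^sup>2 * M.moment a (k + l - 1) \<le> (M ^^ k) a \<bullet> (X ^^ l) a"
proof -
  have "M.moment a (k + l) - (M ^^ k) a \<bullet> (X ^^ l) a
      = (M ^^ k) a \<bullet> (M ^^ l) a - (M ^^ k) a \<bullet> (X ^^ l) a"
    by (simp add: M.moment_def M.pow_inner)
  also have "\<dots> = \<eta> * (\<Sum>i<l. X.moment a (l - Suc i) * M.moment a (k + i))"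
    unfolding pow_diff_inner by (simp add: M.pow_inner X.moment_def M.moment_def)
  also have "\<dots> \<le> \<eta> * (\<Sum>i<l. (norm a)\<^sup>2 * M.moment a (k + l - 1))"
  proof (intro mult_left_mono sum_mono eta)
    fix i assume "i \<in> {..<l}"
    then have eq: "l - Suc i + (k + i) = k + l - 1" by auto
    have "X.moment a (l - Suc i) * M.moment a (k + i) \<le> M.moment a (l - Suc i) * M.moment a (k + i)"
      by (intro mult_right_mono moment_le M.moment_nonneg a_in)
    also have "\<dots> \<le> (norm a)\<^sup>2 * M.moment a (k + l - 1)"
      using M.moment_mult_le[OF a_in, of "l - Suc i" "k + i"] unfolding eq .
    finally show "X.moment a (l - Suc i) * M.moment a (k + i) \<le> (norm a)\<^sup>2 * M.moment a (k + l - 1)" .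
  qed
  finally show ?thesis by (simp add: mult_ac)
qed

text \<open>A second-order Taylor bound in \<eta>. Telescoping expresses the loss of trace through
  mixed moments, and \<open>mixed_moment_ge\<close> exchanges each for a pure moment of
  \<open>M\<close>; the errors proportional to n - i add up to n (n + 1) / 2. At n = 0 the truncated
  index \<open>n - 1\<close> is harmless, its coefficient being 0.\<close>

lemma op_trace_pow_le:
  "op_trace (X ^^ Suc n) \<le> op_trace (M ^^ Suc n) - \<eta> * Suc n * M.moment a n
     + \<eta>\<^sup>2 * (Suc n * n / 2) * (norm a)\<^sup>2 * M.moment a (n - 1)"
proof -
  \<comment> \<open>The trace of a rank-one operator is an inner product, by Parseval over
    \<open>Basis\<close>.\<close>
  have basis: "(\<Sum>b\<in>Basis. (a \<bullet> (X ^^ j) b) * (b \<bullet> (M ^^ i) a)) = (M ^^ i) a \<bullet> (X ^^ j) a" for i j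
  proof -
    have "(\<Sum>b\<in>Basis. (a \<bullet> (X ^^ j) b) * (b \<bullet> (M ^^ i) a))
        = (\<Sum>b\<in>Basis. ((M ^^ i) a \<bullet> b) * ((X ^^ j) a \<bullet> b))"
      by (intro sum.cong refl)
        (simp only: X.pow_sym[of j a, symmetric] inner_commute[of _ "(M ^^ i) a"] mult.commute)
    then show ?thesis by (simp only: euclidean_inner[symmetric])
  qed
  have "op_trace (M ^^ Suc n) - op_trace (X ^^ Suc n)
      = (\<Sum>b\<in>Basis. \<eta> * (\<Sum>i<Suc n. (a \<bullet> (X ^^ (n - i)) b) * (b \<bullet> (M ^^ i) a)))"
    unfolding op_trace_def sum_subtractf[symmetric] pow_diff_inner by simp
  also have "\<dots> = \<eta> * (\<Sum>i<Suc n. \<Sum>b\<in>Basis. (a \<bullet> (X ^^ (n - i)) b) * (b \<bullet> (M ^^ i) a))"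
    unfolding sum_distrib_left[symmetric] by (subst sum.swap) simp
  also have "\<dots> = \<eta> * (\<Sum>i<Suc n. (M ^^ i) a \<bullet> (X ^^ (n - i)) a)"
    unfolding basis ..
  also have "\<dots> \<ge> \<eta> * (\<Sum>i<Suc n. M.moment a n - \<eta> * (n - i) * (norm a)\<^sup>2 * M.moment a (n - 1))"
  proof (intro mult_left_mono sum_mono eta)
    fix i assume "i \<in> {..<Suc n}"
    then show "M.moment a n - \<eta> * (n - i) * (norm a)\<^sup>2 * M.moment a (n - 1)
        \<le> (M ^^ i) a \<bullet> (X ^^ (n - i)) a"
      using mixed_moment_ge[of i "n - i"] by simp
  qed
  also have "(\<Sum>i<Suc n. M.moment a n - \<eta> * (n - i) * (norm a)\<^sup>2 * M.moment a (n - 1))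
      = Suc n * M.moment a n - \<eta> * (\<Sum>i<Suc n. real (n - i)) * (norm a)\<^sup>2 * M.moment a (n - 1)"
    by (simp only: sum_subtractf sum_constant card_lessThan sum_distrib_right sum_distrib_left)
  also have "(\<Sum>i<Suc n. real (n - i)) = Suc n * n / 2"
  proof -
    have "(\<Sum>i<Suc n. real (n - i)) = (\<Sum>i<Suc n. real i)"
      using sum.nat_diff_reindex[of real "Suc n"] by simp
    also have "\<dots> = Suc n * n / 2" by (induction n) (auto simp: field_simps)
    finally show ?thesis .
  qed
  finally show ?thesis by (simp add: algebra_simps power2_eq_square del: funpow.simps)
qed

end

section \<open>Sampling from a tight frame\<close>

text \<open>The frame constant \<open>CARD('d)\<close> makes the operators a_k a_k^T average to the
  identity on \<open>U\<close>. In the application \<open>a k\<close> is the projected basis vector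
  scaled by sqrt d, and \<open>R\<close> is r \<mu>(U).\<close>

locale tight_frame =
  fixes U :: "'a::euclidean_space set" and a :: "'d::finite \<Rightarrow> 'a" and R :: real
  assumes subspace_U: "subspace U" and a_in: "\<And>k. a k \<in> U"
    and norm_a: "\<And>k. (norm (a k))\<^sup>2 \<le> R"
    and frame: "\<And>w. w \<in> U \<Longrightarrow> (\<Sum>k\<in>UNIV. (a k \<bullet> w) *\<^sub>R a k) = real CARD('d) *\<^sub>R w"
begin

text \<open>By the frame identity this average is the orthogonal projection onto
  \<open>U\<close>.\<close>

definition proj :: "'a \<Rightarrow> 'a" where
  "proj w = (1 / real CARD('d)) *\<^sub>R (\<Sum>k\<in>UNIV. (a k \<bullet> w) *\<^sub>R a k)"

definition residual :: "real \<Rightarrow> 'd multiset \<Rightarrow> 'a \<Rightarrow> 'a" where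
  "residual \<eta> A w = proj w - \<eta> *\<^sub>R (\<Sum>k\<in>#A. (a k \<bullet> w) *\<^sub>R a k)"

lemma proj_id: "w \<in> U \<Longrightarrow> proj w = w"
  by (simp add: proj_def frame)

lemma proj_in: "proj w \<in> U"
  unfolding proj_def using subspace_U a_in by (intro subspace_scale subspace_sum) auto

lemma linear_proj: "linear proj"
  unfolding proj_def
  by (intro linearI)
    (simp_all add: inner_add_right scaleR_left_distrib sum.distrib scaleR_right_distrib scaleR_sum_right mult_ac)

lemma proj_sym: "proj x \<bullet> y = x \<bullet> proj y"
  by (simp add: proj_def inner_sum_left inner_sum_right inner_commute mult_ac)

lemma norm_proj_le: "norm (proj w) \<le> norm w"
proof -
  have "(norm (proj w))\<^sup>2 = w \<bullet> proj w"
    by (simp add: power2_norm_eq_inner proj_sym proj_id[OF proj_in])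
  also have "\<dots> \<le> norm w * norm (proj w)" by (rule norm_cauchy_schwarz)
  finally show ?thesis by (cases "proj w = 0") (auto simp: power2_eq_square)
qed

lemma residual_empty: "residual \<eta> {#} = proj"
  by (simp add: residual_def fun_eq_iff)

lemma residual_add_mset:
  "residual \<eta> (add_mset k A) = (\<lambda>w. residual \<eta> A w - (\<eta> * (a k \<bullet> w)) *\<^sub>R a k)"
  by (simp add: residual_def fun_eq_iff scaleR_right_distrib)

lemma linear_residual: "linear (residual \<eta> A)"
proof (induction A)
  case (add k A)
  have "linear (\<lambda>w. (\<eta> * (a k \<bullet> w)) *\<^sub>R a k)"
    by (intro linearI) (simp_all add: inner_simps algebra_simps)
  then show ?case unfolding residual_add_mset by (rule linear_compose_sub[OF add])
qed (simp add: residual_empty linear_proj)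

lemma residual_sym: "residual \<eta> A x \<bullet> y = x \<bullet> residual \<eta> A y"
proof (induction A)
  case (add k A)
  then show ?case
    by (simp add: residual_add_mset inner_diff_left inner_diff_right inner_commute[of x "a k"])
qed (simp add: residual_empty proj_sym)

lemma residual_in: "residual \<eta> A w \<in> U"
  by (induction A)
    (simp_all add: residual_empty residual_add_mset proj_in a_in subspace_diff subspace_scale subspace_U)

lemma residual_quadratic:
  assumes "w \<in> U" shows "w \<bullet> residual \<eta> A w = (norm w)\<^sup>2 - \<eta> * (\<Sum>k\<in>#A. (a k \<bullet> w)\<^sup>2)"
proof (induction A)
  case empty
  then show ?case using assms by (simp add: residual_empty proj_id power2_norm_eq_inner)
next
  case (add k A)
  then show ?case
    by (simp add: residual_add_mset inner_diff_right inner_commute power2_eq_square algebra_simps)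
qed

lemma sum_mset_inner_nonneg: "0 \<le> (\<Sum>k\<in>#A. (a k \<bullet> w)\<^sup>2)"
  by (induction A) auto

lemma sum_mset_inner_le: "(\<Sum>k\<in>#A. (a k \<bullet> w)\<^sup>2) \<le> size A * R * (norm w)\<^sup>2"
proof (induction A)
  case (add k A)
  have "(a k \<bullet> w)\<^sup>2 \<le> (norm (a k))\<^sup>2 * (norm w)\<^sup>2"
    using Cauchy_Schwarz_ineq[of "a k" w] by (simp add: power2_norm_eq_inner)
  also have "\<dots> \<le> R * (norm w)\<^sup>2" by (intro mult_right_mono norm_a) simp
  finally show ?case using add by (simp add: algebra_simps)
qed simp

lemma residual_ge:
  assumes "w \<in> U" "0 \<le> \<eta>" "\<eta> * (size A * R) \<le> \<epsilon>"
  shows "(1 - \<epsilon>) * (norm w)\<^sup>2 \<le> w \<bullet> residual \<eta> A w"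
proof -
  have "\<eta> * (\<Sum>k\<in>#A. (a k \<bullet> w)\<^sup>2) \<le> \<eta> * (size A * R * (norm w)\<^sup>2)"
    by (intro mult_left_mono sum_mset_inner_le assms)
  also have "\<dots> \<le> \<epsilon> * (norm w)\<^sup>2"
    using mult_right_mono[OF assms(3), of "(norm w)\<^sup>2"] by (simp add: mult_ac)
  finally show ?thesis using assms(1) by (simp add: residual_quadratic algebra_simps)
qed

lemma psd_residual:
  assumes "0 \<le> \<eta>" "\<eta> * (size A * R) \<le> 1"
  shows "psd_operator U (residual \<eta> A)"
proof (rule psd_operator.intro)
  show "0 \<le> x \<bullet> residual \<eta> A x" if "x \<in> U" for x
    using residual_ge[OF that assms] by simp
qed (simp_all add: subspace_U linear_residual residual_sym residual_in)

lemma residual_le: "w \<in> U \<Longrightarrow> 0 \<le> \<eta> \<Longrightarrow> w \<bullet> residual \<eta> A w \<le> (norm w)\<^sup>2"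
  using residual_quadratic[of w \<eta> A] sum_mset_inner_nonneg[of w A] by simp

text \<open>An operator between 0 and the identity dominates its own square. With v = Mw,
  Cauchy-Schwarz for the form of M gives |v|^4 \<le> (w . v) (v . Mv), and the last factor is at
  most |v|^2.\<close>

lemma norm_residual_le:
  assumes "w \<in> U" "0 \<le> \<eta>" "\<eta> * (size A * R) \<le> 1"
  shows "(norm (residual \<eta> A w))\<^sup>2 \<le> w \<bullet> residual \<eta> A w"
proof -
  interpret psd_operator U "residual \<eta> A" by (rule psd_residual[OF assms(2,3)])
  define v where "v = residual \<eta> A w"
  have v: "v \<in> U" by (simp add: v_def residual_in)
  have "((norm v)\<^sup>2)\<^sup>2 = (w \<bullet> residual \<eta> A v)\<^sup>2"
    by (simp add: power2_norm_eq_inner v_def residual_sym)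
  also have "\<dots> \<le> (w \<bullet> v) * (v \<bullet> residual \<eta> A v)"
    using cauchy_schwarz[OF assms(1) v] by (simp add: v_def)
  also have "\<dots> \<le> (w \<bullet> v) * (norm v)\<^sup>2"
    using psd[OF assms(1)] by (intro mult_left_mono residual_le v assms) (simp add: v_def)
  finally have "(norm v)\<^sup>2 * (norm v)\<^sup>2 \<le> (w \<bullet> v) * (norm v)\<^sup>2"
    unfolding power2_eq_square[of "(norm v)\<^sup>2"] .
  then have "(norm v)\<^sup>2 \<le> w \<bullet> v"
    using mult_right_le_imp_le[of "(norm v)\<^sup>2" "(norm v)\<^sup>2" "w \<bullet> v"] by (cases "v = 0") auto
  then show ?thesis by (simp add: v_def)
qed

lemma norm_residual_ge:
  assumes "w \<in> U" "0 \<le> \<eta>" "\<eta> * (size A * R) \<le> \<epsilon>" "\<epsilon> \<le> 1"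
  shows "(1 - \<epsilon>)\<^sup>2 * (norm w)\<^sup>2 \<le> (norm (residual \<eta> A w))\<^sup>2"
proof -
  have "(1 - \<epsilon>) * (norm w)\<^sup>2 \<le> norm w * norm (residual \<eta> A w)"
    using residual_ge[OF assms(1-3)] norm_cauchy_schwarz order_trans by blast
  then have "(1 - \<epsilon>) * norm w \<le> norm (residual \<eta> A w)"
    by (cases "w = 0") (auto simp: power2_eq_square)
  then have "((1 - \<epsilon>) * norm w)\<^sup>2 \<le> (norm (residual \<eta> A w))\<^sup>2"
    using assms(4) by (intro power_mono) auto
  then show ?thesis by (simp add: power_mult_distrib)
qed

text \<open>The trace of M^j against the frame operator. Positivity of \<open>j\<close> puts the
  range of M^j inside \<open>U\<close>, where the frame identity applies; the zeroth power is the
  identity of the whole space.\<close>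

lemma sum_moment:
  assumes "psd_operator U M" "0 < j"
  shows "(\<Sum>k\<in>UNIV. psd_operator.moment M (a k) j) = real CARD('d) * op_trace (M ^^ j)"
proof -
  interpret psd_operator U M by fact
  have "(\<Sum>k\<in>UNIV. moment (a k) j) = (\<Sum>k\<in>UNIV. \<Sum>b\<in>Basis. (a k \<bullet> b) * (a k \<bullet> (M ^^ j) b))"
    unfolding moment_def by (subst euclidean_inner) (simp add: pow_sym)
  also have "\<dots> = (\<Sum>b\<in>Basis. b \<bullet> (\<Sum>k\<in>UNIV. (a k \<bullet> (M ^^ j) b) *\<^sub>R a k))"
    by (subst sum.swap) (simp add: inner_sum_right inner_commute mult_ac)
  also have "\<dots> = real CARD('d) * op_trace (M ^^ j)"
    by (simp add: frame pow_in' assms op_trace_def sum_distrib_left)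
  finally show ?thesis .
qed

lemma op_trace_even:
  assumes "psd_operator U M"
  shows "op_trace (M ^^ (i + i)) = (\<Sum>b\<in>Basis. (norm ((M ^^ i) b))\<^sup>2)"
proof -
  interpret psd_operator U M by fact
  show ?thesis by (simp add: op_trace_def moment_even[symmetric] moment_def)
qed

text \<open>Averaging \<open>op_trace_pow_le\<close> over the frame replaces \<open>M.moment (a k) j\<close> by traces of powers;
  since the residual is nearly the identity on \<open>U\<close>, these traces are comparable.\<close>

lemma sum_op_trace_residual_le:
  fixes i :: nat
  defines "N \<equiv> i + i + 4"
  assumes "0 \<le> \<eta>" "\<eta> * (Suc (size A) * R) \<le> \<epsilon>" "\<epsilon> < 1"
  shows "(\<Sum>k\<in>UNIV. op_trace (residual \<eta> (add_mset k A) ^^ N))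
    \<le> real CARD('d) * exp (- (\<eta> * N) + (\<eta> * N)\<^sup>2 * R / (2 * (1 - \<epsilon>)\<^sup>2)) * op_trace (residual \<eta> A ^^ N)"
proof -
  let ?D = "real CARD('d)" and ?M = "residual \<eta> A"
  define T where "T = (\<lambda>j. op_trace (?M ^^ j))"
  have R: "0 \<le> R" using norm_a[of undefined] zero_le_power2 order_trans by blast
  have \<epsilon>: "\<eta> * (size A * R) \<le> \<epsilon>" "\<eta> * (size A * R) \<le> 1"
    using assms R mult_left_mono[of "size A * R" "Suc (size A) * R" \<eta>] by (auto simp: mult_right_mono)
  interpret M: psd_operator U ?M by (rule psd_residual[OF assms(2) \<epsilon>(2)])
  have even: "T (j + j) = (\<Sum>b\<in>Basis. (norm ((?M ^^ j) b))\<^sup>2)" for j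
    unfolding T_def by (rule op_trace_even) unfold_locales
  have odd: "T (Suc (j + j)) = (\<Sum>b\<in>Basis. (?M ^^ j) b \<bullet> ?M ((?M ^^ j) b))" for j
    by (simp add: T_def op_trace_def M.moment_odd[symmetric] M.moment_def)
  \<comment> \<open>\<open>N = 2 * (i + 2)\<close> is even, so \<open>T N\<close> and
    \<open>T (N - 2)\<close> are sums of squares, and the offset 4 leaves at least one factor of
    \<open>?M\<close> in every vector considered, which places it in \<open>U\<close>.\<close>
  have in_U: "(?M ^^ Suc i) b \<in> U" for b by (rule M.pow_in') simp
  have N: "N = Suc (Suc i) + Suc (Suc i)" "N - 1 = Suc (Suc i + Suc i)" "N - 2 = Suc i + Suc i"
    by (simp_all add: N_def)
  have T1: "T N \<le> T (N - 1)"
    unfolding N(2) unfolding N(1) even odd funpow.simps(2)[of "Suc i"] o_apply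
    by (intro sum_mono norm_residual_le in_U assms \<epsilon>)
  have T2: "(1 - \<epsilon>)\<^sup>2 * T (N - 2) \<le> T N"
    unfolding N(3) unfolding N(1) even sum_distrib_left funpow.simps(2)[of "Suc i"] o_apply
    by (intro sum_mono norm_residual_ge in_U assms \<epsilon> less_imp_le)
  have T0: "0 \<le> T N" unfolding N(1) even by (intro sum_nonneg) simp
  have pos: "0 < (1 - \<epsilon>)\<^sup>2" using assms(4) by simp
  have step: "op_trace (residual \<eta> (add_mset k A) ^^ N)
      \<le> T N - \<eta> * N * M.moment (a k) (N - 1) + \<eta>\<^sup>2 * (N * N / 2) * R * M.moment (a k) (N - 2)" for k
  proof -
    have X: "psd_operator U (residual \<eta> (add_mset k A))"
      using assms by (intro psd_residual) auto
    interpret rank_one_downdate U ?M \<eta> "a k"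
      using X unfolding residual_add_mset
      by (intro rank_one_downdate.intro rank_one_downdate_axioms.intro M.psd_operator_axioms a_in assms(2))
    have m: "0 \<le> M.moment (a k) (N - 2)" by (rule M.moment_nonneg[OF a_in])
    have "op_trace (residual \<eta> (add_mset k A) ^^ N) \<le> T N - \<eta> * N * M.moment (a k) (N - 1)
        + \<eta>\<^sup>2 * (N * (N - 1) / 2) * (norm (a k))\<^sup>2 * M.moment (a k) (N - 2)"
      using op_trace_pow_le[of "N - 1"] unfolding residual_add_mset T_def
      by (simp add: N_def numeral_eq_Suc del: funpow.simps)
    also have "\<dots> \<le> T N - \<eta> * N * M.moment (a k) (N - 1)
        + \<eta>\<^sup>2 * (N * N / 2) * R * M.moment (a k) (N - 2)"
      using m R by (intro add_left_mono mult_right_mono mult_mono norm_a) (auto intro!: mult_left_mono)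
    finally show ?thesis .
  qed
  have "(\<Sum>k\<in>UNIV. op_trace (residual \<eta> (add_mset k A) ^^ N)) \<le> (\<Sum>k\<in>UNIV. T N
      - \<eta> * N * M.moment (a k) (N - 1) + \<eta>\<^sup>2 * (N * N / 2) * R * M.moment (a k) (N - 2))"
    by (intro sum_mono step)
  also have "\<dots> = ?D * T N - \<eta> * N * (\<Sum>k\<in>UNIV. M.moment (a k) (N - 1))
      + \<eta>\<^sup>2 * (N * N / 2) * R * (\<Sum>k\<in>UNIV. M.moment (a k) (N - 2))"
    by (simp add: sum.distrib sum_subtractf sum_distrib_left)
  also have "\<dots> = ?D * (T N - \<eta> * N * T (N - 1) + \<eta>\<^sup>2 * (N * N / 2) * R * T (N - 2))"
    using sum_moment[OF M.psd_operator_axioms, of "N - 1"] sum_moment[OF M.psd_operator_axioms, of "N - 2"]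
    by (simp add: T_def N_def algebra_simps)
  \<comment> \<open>\<open>T1\<close> and \<open>T2\<close> express everything through
    \<open>T N\<close>, so one sample multiplies the potential by a constant factor.\<close>
  also have "\<dots> \<le> ?D * (T N - \<eta> * N * T N + \<eta>\<^sup>2 * (N * N / 2) * R * (T N / (1 - \<epsilon>)\<^sup>2))"
    using T1 T2 R pos assms(2) by (intro mult_left_mono add_mono diff_mono) (auto simp: field_simps)
  also have "\<dots> = ?D * (1 + (- (\<eta> * N) + (\<eta> * N)\<^sup>2 * R / (2 * (1 - \<epsilon>)\<^sup>2))) * T N"
    by (simp add: algebra_simps power2_eq_square)
  also have "\<dots> \<le> ?D * exp (- (\<eta> * N) + (\<eta> * N)\<^sup>2 * R / (2 * (1 - \<epsilon>)\<^sup>2)) * T N"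
    using T0 by (intro mult_right_mono mult_left_mono exp_ge_add_one_self) auto
  finally show ?thesis by (simp add: T_def)
qed

text \<open>The trace of an even power is the squared Hilbert-Schmidt norm of half that power, which
  dominates its value on any unit vector.\<close>

lemma op_trace_residual_ge:
  assumes "u \<in> U" "norm u = 1" "0 \<le> \<eta>" "\<eta> * (size A * R) \<le> 1"
  shows "(u \<bullet> residual \<eta> A u) ^ (i + i) \<le> op_trace (residual \<eta> A ^^ (i + i))"
proof -
  let ?M = "residual \<eta> A"
  interpret psd_operator U ?M by (rule psd_residual[OF assms(3,4)])
  have "(u \<bullet> ?M u) ^ (i + i) \<le> moment u (i + i)" by (rule moment_ge_power[OF assms(1,2)])
  also have "\<dots> = (norm ((?M ^^ i) (\<Sum>b\<in>Basis. (u \<bullet> b) *\<^sub>R b)))\<^sup>2"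
    by (simp add: moment_even euclidean_representation)
  also have "\<dots> = (norm (\<Sum>b\<in>Basis. (u \<bullet> b) *\<^sub>R (?M ^^ i) b))\<^sup>2"
    by (simp add: linear_sum[OF linear_pow] linear_cmul[OF linear_pow])
  also have "\<dots> \<le> (\<Sum>b\<in>Basis. \<bar>u \<bullet> b\<bar> * norm ((?M ^^ i) b))\<^sup>2"
    by (intro power_mono sum_norm_le) auto
  also have "\<dots> \<le> (\<Sum>b\<in>Basis. \<bar>u \<bullet> b\<bar>\<^sup>2) * (\<Sum>b\<in>Basis. (norm ((?M ^^ i) b))\<^sup>2)"
    by (rule Cauchy_Schwarz_ineq_sum)
  also have "(\<Sum>b\<in>Basis. \<bar>u \<bullet> b\<bar>\<^sup>2) = 1"
    using euclidean_inner[of u u] assms(2) by (simp add: power2_eq_square norm_eq_1)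
  finally show ?thesis by (simp add: op_trace_even[OF psd_operator_axioms])
qed

text \<open>The lower tail of the matrix Chernoff bound. The power (P - (\<theta>/N) S)^N plays the
  role of exp(-\<theta> S): each N gives a Markov bound, and N tends to infinity at the end.\<close>

lemma prob_frame_le:
  assumes "0 < R" "0 < \<gamma>" "\<gamma> < 1"
  shows "measure_pmf.prob (pmf_of_set (UNIV :: ('m::finite \<Rightarrow> 'd) set))
      {\<Omega>. \<exists>u\<in>U. norm u = 1 \<and> (\<Sum>j\<in>UNIV. (a (\<Omega> j) \<bullet> u)\<^sup>2) \<le> (1 - \<gamma>) * real CARD('m)}
    \<le> DIM('a) * exp (- \<gamma>\<^sup>2 * real CARD('m) / (2 * R))" (is "measure_pmf.prob ?p ?B \<le> _")
proof -
  let ?m = "real CARD('m)"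
  \<comment> \<open>The minimiser of m (\<theta>^2 R / 2 - \<theta> \<gamma>), the exponent left in
    the limit.\<close>
  define \<theta> where "\<theta> = \<gamma> / R"
  have \<theta>: "0 < \<theta>" using assms by (simp add: \<theta>_def)
  define x where "x = \<theta> * (1 - \<gamma>) * ?m"
  define N where "N = (\<lambda>i::nat. i + i + 4)"
  define \<epsilon> where "\<epsilon> = (\<lambda>i. \<theta> / N i * (?m * R))"
  define c where "c = (\<lambda>i. exp (- \<theta> + \<theta>\<^sup>2 * R / (2 * (1 - \<epsilon> i)\<^sup>2)))"
  have bound: "measure_pmf.prob ?p ?B \<le> c i ^ CARD('m) * DIM('a) / (1 - x / N i) ^ N i"
    if i: "\<epsilon> i < 1" "x / N i < 1" for i
  proof -
    define \<eta> where "\<eta> = \<theta> / N i"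
    have \<eta>: "0 \<le> \<eta>" "\<eta> * N i = \<theta>" using \<theta> by (auto simp: \<eta>_def N_def)
    have sz: "\<eta> * (real n * R) \<le> \<epsilon> i" if "n \<le> CARD('m)" for n
      using that assms \<theta> unfolding \<epsilon>_def \<eta>_def
      by (intro mult_left_mono mult_right_mono) auto
    have Ni: "i + i + 4 = N i" by (simp add: N_def)
    have Suc_eq: "N i = (i + 2) + (i + 2)" by (simp add: N_def)
    have "measure_pmf.prob ?p ?B
        \<le> c i ^ CARD('m) * (\<lambda>A. op_trace (residual \<eta> A ^^ N i)) {#} / (1 - x / N i) ^ N i"
    proof (rule prob_sample_le)
      fix A :: "'d multiset" assume "size A \<le> CARD('m)"
      then have "\<eta> * (size A * R) \<le> 1" using sz[of "size A"] i by simp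
      from op_trace_even[OF psd_residual[OF \<eta>(1) this]]
      show "0 \<le> op_trace (residual \<eta> A ^^ N i)" unfolding Suc_eq by (simp only: sum_nonneg zero_le_power2)
    next
      fix A :: "'d multiset" assume "size A < CARD('m)"
      then have "\<eta> * (Suc (size A) * R) \<le> \<epsilon> i" by (intro sz) simp
      from sum_op_trace_residual_le[OF \<eta>(1) this i(1), of i]
      show "(\<Sum>k\<in>UNIV. op_trace (residual \<eta> (add_mset k A) ^^ N i))
          \<le> real CARD('d) * c i * op_trace (residual \<eta> A ^^ N i)"
        unfolding c_def by (simp only: Ni \<eta>(2))
    next
      fix \<Omega> :: "'m \<Rightarrow> 'd" assume "\<Omega> \<in> ?B"
      then obtain u where u: "u \<in> U" "norm u = 1" "(\<Sum>k\<in>#sample \<Omega>. (a k \<bullet> u)\<^sup>2) \<le> (1 - \<gamma>) * ?m"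
        by (auto simp: sum_unfold_sum_mset multiset.map_comp o_def)
      have "1 - x / N i \<le> u \<bullet> residual \<eta> (sample \<Omega>) u"
        using mult_left_mono[OF u(3) \<eta>(1)] u(2)
        by (simp add: residual_quadratic[OF u(1)] x_def \<eta>_def mult_ac)
      then have "(1 - x / N i) ^ N i \<le> (u \<bullet> residual \<eta> (sample \<Omega>) u) ^ N i"
        using i by (intro power_mono) auto
      also have "\<dots> \<le> op_trace (residual \<eta> (sample \<Omega>) ^^ N i)"
        unfolding Suc_eq using sz[of "CARD('m)"] i by (intro op_trace_residual_ge u \<eta>) simp
      finally show "(1 - x / N i) ^ N i \<le> op_trace (residual \<eta> (sample \<Omega>) ^^ N i)" .
    qed (use i in \<open>auto simp: c_def\<close>)
    \<comment> \<open>\<open>proj\<close> is a contraction, so the potential starts at no more than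
      \<open>DIM('a)\<close>; this is the dimension factor of the bound.\<close>
    also have "op_trace (residual \<eta> {#} ^^ N i) \<le> DIM('a)"
    proof -
      have psd: "psd_operator U proj" using psd_residual[of 0 "{#}"] by (simp add: residual_empty)
      have "norm ((proj ^^ j) b) \<le> norm b" for j b
        by (induction j) (auto intro: order_trans[OF norm_proj_le])
      then have "(norm ((proj ^^ j) b))\<^sup>2 \<le> 1" if "b \<in> Basis" for j b
        using that by (metis norm_Basis norm_ge_zero power_le_one)
      then have "(\<Sum>b\<in>Basis. (norm ((proj ^^ (i + 2)) b))\<^sup>2) \<le> (\<Sum>b\<in>(Basis::'a set). 1)"
        by (intro sum_mono)
      then show ?thesis
        unfolding residual_empty Suc_eq op_trace_even[OF psd] by simp
    qed
    finally show ?thesis using i by (simp add: divide_right_mono mult_left_mono c_def)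
  qed
  have N_top: "filterlim N at_top sequentially"
    unfolding N_def by (rule filterlim_subseq) (auto simp: strict_mono_def)
  have lim0: "(\<lambda>i. y / real (N i)) \<longlonglongrightarrow> 0" for y
    using filterlim_compose[OF lim_const_over_n[of y] N_top] by simp
  have \<epsilon>0: "\<epsilon> \<longlonglongrightarrow> 0"
    using lim0[of "\<theta> * (?m * R)"] by (simp add: \<epsilon>_def)
  have "eventually (\<lambda>i. \<epsilon> i < 1 \<and> x / N i < 1) sequentially"
    using order_tendstoD(2)[OF \<epsilon>0, of 1] order_tendstoD(2)[OF lim0[of x], of 1]
    by (auto intro: eventually_conj)
  then have ev: "eventually (\<lambda>i. measure_pmf.prob ?p ?B
      \<le> c i ^ CARD('m) * DIM('a) / (1 - x / N i) ^ N i) sequentially"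
    by (rule eventually_mono) (use bound in blast)
  have "(\<lambda>i. (1 + (- x) / real (N i)) ^ N i) \<longlonglongrightarrow> exp (- x)"
    by (rule filterlim_compose[OF tendsto_exp_limit_sequentially N_top])
  moreover have "c \<longlonglongrightarrow> exp (- \<theta> + \<theta>\<^sup>2 * R / (2 * (1 - 0)\<^sup>2))"
    unfolding c_def by (intro tendsto_intros \<epsilon>0) simp
  ultimately have "(\<lambda>i. c i ^ CARD('m) * DIM('a) / (1 + (- x) / N i) ^ N i)
      \<longlonglongrightarrow> exp (- \<theta> + \<theta>\<^sup>2 * R / (2 * (1 - 0)\<^sup>2)) ^ CARD('m) * DIM('a) / exp (- x)"
    by (intro tendsto_intros) auto
  \<comment> \<open>The probability does not depend on \<open>i\<close>, so the bound survives the
    limit, in which \<open>\<epsilon> i\<close> vanishes and the denominator tends to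
    \<open>exp (- x)\<close>.\<close>
  then have "measure_pmf.prob ?p ?B
      \<le> exp (- \<theta> + \<theta>\<^sup>2 * R / (2 * (1 - 0)\<^sup>2)) ^ CARD('m) * DIM('a) / exp (- x)"
    using ev by (intro tendsto_lowerbound[where F = sequentially]) auto
  also have "\<dots> = DIM('a) * exp (?m * (- \<theta> + \<theta>\<^sup>2 * R / (2 * (1 - 0)\<^sup>2)) + x)"
    unfolding exp_add[of "_ * _"] exp_of_nat_mult exp_minus by (simp only: divide_inverse inverse_inverse_eq mult_ac)
  also have "?m * (- \<theta> + \<theta>\<^sup>2 * R / (2 * (1 - 0)\<^sup>2)) + x = - \<gamma>\<^sup>2 * ?m / (2 * R)"
    using assms(1) by (simp add: x_def \<theta>_def field_simps power2_eq_square)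
  finally show ?thesis .
qed

end

section \<open>Projection residuals of sampled vectors\<close>

lemma proj_onto_eqI:
  assumes "subspace S" "p \<in> S" "\<And>s. s \<in> S \<Longrightarrow> (x - p) \<bullet> s = 0"
  shows "proj_onto S x = p"
  unfolding proj_onto_def
proof (rule the_equality)
  fix q assume q: "q \<in> S \<and> (\<forall>s\<in>S. (x - q) \<bullet> s = 0)"
  then have "q - p \<in> S" using assms by (simp add: subspace_diff)
  then have "(x - p) \<bullet> (q - p) - (x - q) \<bullet> (q - p) = 0" using q assms(3) by simp
  then have "(q - p) \<bullet> (q - p) = 0" by (simp add: inner_diff_left)
  then show "q = p" by simp
qed (use assms in auto)

lemma
  assumes "subspace S"
  shows proj_onto_in: "proj_onto S x \<in> S"
    and proj_onto_orthogonal: "s \<in> S \<Longrightarrow> (x - proj_onto S x) \<bullet> s = 0"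
proof -
  have span: "span S = S" using assms by (simp add: span_eq_iff)
  obtain y z where yz: "y \<in> S" "\<And>w. w \<in> S \<Longrightarrow> orthogonal z w" "x = y + z"
    using orthogonal_subspace_decomp_exists[of S x] unfolding span by metis
  then have "proj_onto S x = y"
    using assms by (intro proj_onto_eqI) (auto simp: orthogonal_def)
  then show "proj_onto S x \<in> S" "s \<in> S \<Longrightarrow> (x - proj_onto S x) \<bullet> s = 0"
    using yz by (auto simp: orthogonal_def)
qed

lemma proj_onto_add_left:
  assumes "subspace S" "x \<in> S"
  shows "proj_onto S (x + y) = x + proj_onto S y"
  by (rule proj_onto_eqI)
    (use assms proj_onto_orthogonal[OF assms(1)] in \<open>auto simp: subspace_add proj_onto_in\<close>)

lemma norm_proj_onto:
  assumes "subspace S"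
  shows "(norm (x - proj_onto S x))\<^sup>2 = (norm x)\<^sup>2 - (norm (proj_onto S x))\<^sup>2"
    and "x \<bullet> proj_onto S x = (norm (proj_onto S x))\<^sup>2"
proof -
  have "(x - proj_onto S x) \<bullet> proj_onto S x = 0"
    using assms by (intro proj_onto_orthogonal proj_onto_in)
  then show "x \<bullet> proj_onto S x = (norm (proj_onto S x))\<^sup>2"
    by (simp add: power2_norm_eq_inner inner_diff_left)
  then show "(norm (x - proj_onto S x))\<^sup>2 = (norm x)\<^sup>2 - (norm (proj_onto S x))\<^sup>2"
    by (simp add: power2_norm_eq_inner inner_diff inner_commute)
qed

lemma linear_restr: "linear (restr \<Omega>)"
  by (intro linearI) (simp_all add: restr_def vec_eq_iff)

lemma subspace_restr_subspace: "subspace U \<Longrightarrow> subspace (restr_subspace \<Omega> U)"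
  unfolding restr_subspace_def by (rule linear_subspace_image[OF linear_restr])

lemma norm_restr: "(norm (restr \<Omega> z))\<^sup>2 = (\<Sum>j\<in>UNIV. (z $ \<Omega> j)\<^sup>2)"
  unfolding power2_norm_eq_inner inner_vec_def by (simp add: restr_def power2_eq_square)

lemma norm_vec_sum: "(norm (z :: real^'n))\<^sup>2 = (\<Sum>k\<in>UNIV. (z $ k)\<^sup>2)"
  unfolding power2_norm_eq_inner inner_vec_def by (simp add: power2_eq_square)

lemma inner_proj_std_basis:
  assumes "subspace U" "u \<in> U"
  shows "proj_onto U (std_basis k) \<bullet> u = u $ k"
  using proj_onto_orthogonal[OF assms, of "std_basis k"]
  by (simp add: inner_diff_left std_basis_def inner_axis')

lemma sum_proj_std_basis:
  fixes U :: "(real^'d::finite) set"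
  assumes "subspace U"
  shows "(\<Sum>k\<in>UNIV. z $ k *\<^sub>R proj_onto U (std_basis k)) = proj_onto U z"
proof (rule sym, rule proj_onto_eqI[OF assms])
  show "(\<Sum>k\<in>UNIV. z $ k *\<^sub>R proj_onto U (std_basis k)) \<in> U"
    by (intro subspace_sum subspace_scale proj_onto_in assms)
  fix s assume "s \<in> U"
  then show "(z - (\<Sum>k\<in>UNIV. z $ k *\<^sub>R proj_onto U (std_basis k))) \<bullet> s = 0"
    by (simp add: inner_diff_left inner_sum_left inner_proj_std_basis[OF assms]) (simp add: inner_vec_def)
qed

text \<open>Writing the projection as p = u_\<Omega> with u in \<open>U\<close> gives |p|^2 = Z . u
  \<le> |Z| |u|, while \<open>\<kappa>\<close> bounds |u| by |p|. This replaces inverting the Gram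
  matrix.\<close>

lemma norm_proj_restr_le:
  fixes U :: "(real^'d::finite) set" and \<Omega> :: "'m::finite \<Rightarrow> 'd"
  assumes U: "subspace U" and "0 < \<kappa>"
    and \<kappa>: "\<And>u. u \<in> U \<Longrightarrow> \<kappa> * (norm u)\<^sup>2 \<le> (norm (restr \<Omega> u))\<^sup>2"
  shows "(norm (proj_onto (restr_subspace \<Omega> U) (restr \<Omega> v)))\<^sup>2
    \<le> (norm (\<Sum>j\<in>UNIV. v $ \<Omega> j *\<^sub>R proj_onto U (std_basis (\<Omega> j))))\<^sup>2 / \<kappa>"
proof -
  let ?W = "restr_subspace \<Omega> U" and ?Z = "\<Sum>j\<in>UNIV. v $ \<Omega> j *\<^sub>R proj_onto U (std_basis (\<Omega> j))"
  define p where "p = proj_onto ?W (restr \<Omega> v)"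
  have W: "subspace ?W" using U by (rule subspace_restr_subspace)
  obtain u where u: "u \<in> U" "p = restr \<Omega> u"
    using proj_onto_in[OF W, of "restr \<Omega> v"] by (auto simp: p_def restr_subspace_def)
  have "(norm p)\<^sup>2 = restr \<Omega> v \<bullet> restr \<Omega> u"
    using norm_proj_onto(2)[OF W, of "restr \<Omega> v"] u by (simp add: p_def)
  also have "\<dots> = ?Z \<bullet> u"
    by (simp add: inner_sum_left inner_proj_std_basis[OF U u(1)]) (simp add: inner_vec_def restr_def)
  also have "\<dots> \<le> norm ?Z * norm u" by (rule norm_cauchy_schwarz)
  \<comment> \<open>Squaring brings in |u|^2, which the hypothesis on \<open>\<kappa>\<close>
    converts into |p|^2; one factor |p|^2 then cancels.\<close>
  finally have "((norm p)\<^sup>2)\<^sup>2 \<le> (norm ?Z * norm u)\<^sup>2" by (intro power_mono) auto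
  then have "\<kappa> * ((norm p)\<^sup>2 * (norm p)\<^sup>2) \<le> (norm ?Z)\<^sup>2 * (\<kappa> * (norm u)\<^sup>2)"
    using assms(2) by (simp add: power_mult_distrib power2_eq_square[of "(norm p)\<^sup>2"] mult_ac)
  also have "\<dots> \<le> (norm ?Z)\<^sup>2 * (norm p)\<^sup>2"
    unfolding u(2) by (intro mult_left_mono \<kappa> u) simp
  finally have "(\<kappa> * (norm p)\<^sup>2) * (norm p)\<^sup>2 \<le> (norm ?Z)\<^sup>2 * (norm p)\<^sup>2" by (simp add: mult.assoc)
  then have "\<kappa> * (norm p)\<^sup>2 \<le> (norm ?Z)\<^sup>2"
    using mult_right_le_imp_le[of "\<kappa> * (norm p)\<^sup>2" "(norm p)\<^sup>2" "(norm ?Z)\<^sup>2"] by (cases "p = 0") auto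
  then show ?thesis using assms(2) by (simp add: p_def field_simps)
qed

text \<open>The trivial subspace is split off because \<open>coh_subspace\<close> divides by
  \<open>dim U\<close>.\<close>

lemma norm_proj_std_basis_le:
  fixes U :: "(real^'d::finite) set"
  assumes U: "subspace U"
  shows "real CARD('d) * (norm (proj_onto U (std_basis k)))\<^sup>2 \<le> real (dim U) * coh_subspace U"
proof (cases "dim U = 0")
  case True
  then have "proj_onto U (std_basis k) = 0"
    using proj_onto_in[OF U, of "std_basis k"] by auto
  then show ?thesis unfolding True by simp
next
  case False
  then have "real (dim U) * coh_subspace U
      = real CARD('d) * (MAX i\<in>(UNIV::'d set). (norm (proj_onto U (std_basis i)))\<^sup>2)"
    by (simp add: coh_subspace_def)
  then show ?thesis by (simp add: Max_ge)
qed

section \<open>Tail bounds for the four bad events\<close>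

text \<open>With s^2 = 2 L / n the deviation is s + s^2/3, and s^2 (1 + \<alpha>/3) \<le> \<alpha>^2
  holds by comparing coefficients of powers of s.\<close>

lemma bernstein_exponents:
  fixes L n :: real
  assumes "0 < n" "0 < L"
  defines "\<alpha> \<equiv> sqrt (2 / n * L) + 2 / (3 * n) * L"
  shows "0 < \<alpha>" "L \<le> n * \<alpha>\<^sup>2 / (2 * (1 + \<alpha> / 3))" "L \<le> n * \<alpha>\<^sup>2 / 2"
proof -
  define s where "s = sqrt (2 / n * L)"
  have s: "0 < s" "s\<^sup>2 = 2 / n * L" using assms by (simp_all add: s_def)
  have \<alpha>: "\<alpha> = s + s\<^sup>2 / 3" unfolding \<alpha>_def s_def[symmetric] s(2) by simp
  show "0 < \<alpha>" using s(1) by (simp add: \<alpha> add_pos_pos)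
  have L: "L = n * s\<^sup>2 / 2" using assms s(2) by simp
  have "s\<^sup>2 * (1 + \<alpha> / 3) \<le> \<alpha>\<^sup>2"
    using s(1) by (simp add: \<alpha> power2_eq_square algebra_simps)
  then have "s\<^sup>2 \<le> \<alpha>\<^sup>2 / (1 + \<alpha> / 3)" using \<open>0 < \<alpha>\<close> by (simp add: pos_le_divide_eq)
  then have "n * s\<^sup>2 / 2 \<le> n * (\<alpha>\<^sup>2 / (1 + \<alpha> / 3)) / 2"
    using assms(1) by (intro divide_right_mono mult_left_mono) auto
  then show 1: "L \<le> n * \<alpha>\<^sup>2 / (2 * (1 + \<alpha> / 3))" by (simp add: L mult.commute)
  also have "\<dots> \<le> n * \<alpha>\<^sup>2 / 2" using \<open>0 < \<alpha>\<close> assms(1) by (intro divide_left_mono) auto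
  finally show "L \<le> n * \<alpha>\<^sup>2 / 2" .
qed

lemma prob_ge_compl_four:
  assumes "- S \<subseteq> A \<union> B \<union> C \<union> D"
    and "measure_pmf.prob p A \<le> \<delta>" "measure_pmf.prob p B \<le> \<delta>"
    and "measure_pmf.prob p C \<le> \<delta>" "measure_pmf.prob p D \<le> \<delta>"
  shows "1 - 4 * \<delta> \<le> measure_pmf.prob p S"
proof -
  have "measure_pmf.prob p (- S) \<le> measure_pmf.prob p (A \<union> B \<union> C \<union> D)"
    using assms(1) by (intro measure_pmf.finite_measure_mono) auto
  also have "\<dots> \<le> measure_pmf.prob p A + measure_pmf.prob p B + measure_pmf.prob p C + measure_pmf.prob p D"
    by (intro measure_Un_le[THEN order_trans] add_mono order_refl) auto
  finally show ?thesis
    using assms(2-) measure_pmf.prob_compl[of S p] by (simp add: Compl_eq_Diff_UNIV)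
qed

lemma exp_minus_ln_inverse: "0 < \<delta> \<Longrightarrow> ln (1 / \<delta>) \<le> y \<Longrightarrow> exp (- y) \<le> (\<delta> :: real)"
  by (simp add: ln_div ln_ge_iff[symmetric])

lemma coh_vec_pos_bound:
  fixes v :: "real^'d::finite"
  assumes "v \<noteq> 0"
  obtains M where "0 < M" "\<And>k. (v $ k)\<^sup>2 \<le> M" "coh_vec v = real CARD('d) * M / (norm v)\<^sup>2"
proof
  let ?m = "MAX i\<in>(UNIV::'d set). \<bar>v $ i\<bar>"
  have ge: "\<bar>v $ k\<bar> \<le> ?m" for k by (simp add: Max_ge)
  show "(v $ k)\<^sup>2 \<le> ?m\<^sup>2" for k using power_mono[OF ge[of k], of 2] by simp
  obtain k where "v $ k \<noteq> 0" using assms by (auto simp: vec_eq_iff)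
  then show "0 < ?m\<^sup>2" using ge[of k] by (intro zero_less_power) linarith
qed (simp add: coh_vec_def)

lemma prob_norm_restr_ge:
  fixes v :: "real^'d::finite"
  assumes "v \<noteq> 0" "0 < \<delta>" "\<delta> < 1"
  defines "\<alpha> \<equiv> sqrt (2 * coh_vec v / real CARD('m) * ln (1 / \<delta>))
    + 2 * coh_vec v / (3 * real CARD('m)) * ln (1 / \<delta>)"
  shows "measure_pmf.prob (pmf_of_set (UNIV :: ('m::finite \<Rightarrow> 'd) set))
      {\<Omega>. (1 + \<alpha>) * real CARD('m) / real CARD('d) * (norm v)\<^sup>2 \<le> (norm (restr \<Omega> v))\<^sup>2} \<le> \<delta>"
    and "measure_pmf.prob (pmf_of_set (UNIV :: ('m::finite \<Rightarrow> 'd) set))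
      {\<Omega>. (norm (restr \<Omega> v))\<^sup>2 \<le> (1 - \<alpha>) * real CARD('m) / real CARD('d) * (norm v)\<^sup>2} \<le> \<delta>"
proof -
  let ?D = "real CARD('d)" and ?m = "real CARD('m)"
  obtain M where M: "0 < M" "\<And>k. (v $ k)\<^sup>2 \<le> M" "coh_vec v = ?D * M / (norm v)\<^sup>2"
    using coh_vec_pos_bound[OF assms(1)] by metis
  define \<mu> where "\<mu> = (norm v)\<^sup>2 / ?D"
  have \<mu>: "0 < \<mu>" "(\<Sum>k\<in>UNIV. (v $ k)\<^sup>2) = ?D * \<mu>" 
    using assms(1) by (simp add: \<mu>_def) (simp add: \<mu>_def norm_vec_sum)
  \<comment> \<open>The effective sample size m / \<mu>(v), since M / \<mu> is the coherence of
    \<open>v\<close>.\<close>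
  define n where "n = ?m * (\<mu> / M)"
  have n: "0 < n" using M \<mu> by (simp add: n_def)
  have L: "0 < ln (1 / \<delta>)" using assms by simp
  have coh: "2 * coh_vec v / ?m = 2 / n" "2 * coh_vec v / (3 * ?m) = 2 / (3 * n)"
    by (simp_all add: n_def \<mu>_def M(3))
  note b = bernstein_exponents[OF n L, folded coh, folded \<alpha>_def]
  have "measure_pmf.prob (pmf_of_set (UNIV :: ('m \<Rightarrow> 'd) set))
      {\<Omega>. (1 + \<alpha>) * ?m * \<mu> \<le> (\<Sum>j\<in>UNIV. (v $ \<Omega> j)\<^sup>2)} \<le> exp (- (n * \<alpha>\<^sup>2 / (2 * (1 + \<alpha> / 3))))"
    using prob_sum_ge[OF _ M(2) \<mu>(2,1) b(1)] by (simp add: n_def)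
  also have "\<dots> \<le> \<delta>" by (intro exp_minus_ln_inverse assms b)
  finally show "measure_pmf.prob (pmf_of_set (UNIV :: ('m::finite \<Rightarrow> 'd) set))
      {\<Omega>. (1 + \<alpha>) * ?m / ?D * (norm v)\<^sup>2 \<le> (norm (restr \<Omega> v))\<^sup>2} \<le> \<delta>"
    by (simp add: norm_restr \<mu>_def)
  have "measure_pmf.prob (pmf_of_set (UNIV :: ('m \<Rightarrow> 'd) set))
      {\<Omega>. (\<Sum>j\<in>UNIV. (v $ \<Omega> j)\<^sup>2) \<le> (1 - \<alpha>) * ?m * \<mu>} \<le> exp (- (n * \<alpha>\<^sup>2 / 2))"
    using prob_sum_le[OF _ M(2) \<mu>(2) M(1) b(1)] by (simp add: n_def)
  also have "\<dots> \<le> \<delta>" by (intro exp_minus_ln_inverse assms b)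
  finally show "measure_pmf.prob (pmf_of_set (UNIV :: ('m::finite \<Rightarrow> 'd) set))
      {\<Omega>. (norm (restr \<Omega> v))\<^sup>2 \<le> (1 - \<alpha>) * ?m / ?D * (norm v)\<^sup>2} \<le> \<delta>"
    by (simp add: norm_restr \<mu>_def)
qed

text \<open>The tail bound \<open>exp (13 / 6 - t)\<close> at \<open>t = 1 + 2 ln (1 / \<delta>)\<close> is at most \<open>\<delta>\<close> only when \<open>\<delta>\<close> is
  small; for \<open>\<delta> \<ge> 1/4\<close> the main theorem is void.\<close>

lemma prob_norm_sum_proj_gt:
  fixes U :: "(real^'d::finite) set" and v :: "real^'d"
  assumes U: "subspace U" and v: "v \<noteq> 0" "\<And>u. u \<in> U \<Longrightarrow> v \<bullet> u = 0"
    and \<delta>: "0 < \<delta>" "\<delta> < 1 / 4"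
    and m: "4 * coh_vec v * ln (1 / \<delta>) \<le> real CARD('m::finite)"
  shows "measure_pmf.prob (pmf_of_set (UNIV :: ('m \<Rightarrow> 'd) set))
      {\<Omega>. (1 + 2 * ln (1 / \<delta>))\<^sup>2 * (real CARD('m) * (real (dim U) * coh_subspace U) * (norm v)\<^sup>2 / (real CARD('d))\<^sup>2)
        < (norm (\<Sum>j\<in>UNIV. v $ \<Omega> j *\<^sub>R proj_onto U (std_basis (\<Omega> j))))\<^sup>2} \<le> \<delta>"
    (is "measure_pmf.prob _ {\<Omega>. ?\<beta> * ?V < (norm (?Z \<Omega>))\<^sup>2} \<le> \<delta>")
proof -
  let ?D = "real CARD('d)" and ?m = "real CARD('m)" and ?L = "ln (1 / \<delta>)"
  let ?a = "\<lambda>k. proj_onto U (std_basis k)"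
  define R where "R = real (dim U) * coh_subspace U"
  have a_le: "?D * (norm (?a k))\<^sup>2 \<le> R" for k
    unfolding R_def by (rule norm_proj_std_basis_le[OF U])
  have "0 \<le> ?D * (norm (?a undefined))\<^sup>2" by simp
  also have "\<dots> \<le> R" by (rule a_le)
  finally have "0 \<le> R" .
  then consider "R = 0" | "0 < R" by linarith
  then show ?thesis
  proof cases
    case 1
    \<comment> \<open>All projected basis vectors vanish, so the event reads 0 < 0 and is
      empty.\<close>
    then have "?a k = 0" for k using a_le[of k] by (simp add: mult_le_0_iff)
    then show ?thesis using 1 \<delta> by (simp add: R_def[symmetric])
  next
    case 2
    \<comment> \<open>An upper bound for the second moment of |Z|; dividing by its square root
      normalises the summands for \<open>prob_norm_sum_ge\<close>.\<close>
    define V where "V = ?m * R * (norm v)\<^sup>2 / ?D\<^sup>2"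
    have V: "0 < V" using 2 v(1) by (simp add: V_def)
    obtain M where M: "0 < M" "\<And>k. (v $ k)\<^sup>2 \<le> M" "coh_vec v = ?D * M / (norm v)\<^sup>2"
      using coh_vec_pos_bound[OF v(1)] by metis
    \<comment> \<open>From \<delta> < 1/4. The bound serves twice: L \<ge> 1 turns the assumption on
      m into |Y|^2 \<le> 1/4, and L \<ge> 7/6 absorbs the constant in the tail.\<close>
    have L: "4 / 3 \<le> ?L"
    proof -
      have "4 / 3 \<le> ln (2::real) + ln 2" using ln2_ge_two_thirds by simp
      also have "\<dots> = ln (4::real)" using ln_mult[of "2::real" 2] by simp
      also have "\<dots> \<le> ?L" using \<delta> by (simp add: field_simps)
      finally show ?thesis .
    qed
    define Y where "Y = (\<lambda>k. (v $ k / sqrt V) *\<^sub>R ?a k)"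
    have normY: "(norm (Y k))\<^sup>2 \<le> (v $ k)\<^sup>2 * (R / ?D) / V" for k
    proof -
      have "(norm (Y k))\<^sup>2 = (v $ k)\<^sup>2 * (norm (?a k))\<^sup>2 / V"
        using V by (simp add: Y_def power_mult_distrib power_divide)
      also have "\<dots> \<le> (v $ k)\<^sup>2 * (R / ?D) / V"
        using V a_le[of k] by (intro divide_right_mono mult_left_mono) (auto simp: field_simps)
      finally show ?thesis .
    qed
    have sumY: "(\<Sum>j\<in>S. (v $ f j / sqrt V) *\<^sub>R ?a (f j)) = (1 / sqrt V) *\<^sub>R (\<Sum>j\<in>S. v $ f j *\<^sub>R ?a (f j))"
      for f :: "'e \<Rightarrow> 'd" and S by (simp add: scaleR_sum_right)
    have "measure_pmf.prob (pmf_of_set (UNIV :: ('m \<Rightarrow> 'd) set))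
      {\<Omega>. 1 + 2 * ?L \<le> norm (\<Sum>j\<in>UNIV. Y (\<Omega> j))} \<le> exp (13 / 6 - (1 + 2 * ?L))"
    proof (rule prob_norm_sum_ge)
      \<comment> \<open>The summands have mean zero because their total is a multiple of the
        projection of \<open>v\<close>, and \<open>v\<close> is orthogonal to
        \<open>U\<close>.\<close>
      have "proj_onto U v = 0" by (rule proj_onto_eqI[OF U]) (auto simp: v subspace_0[OF U])
      then show "(\<Sum>k\<in>UNIV. Y k) = 0"
        using sumY[of "\<lambda>k. k" UNIV] by (simp add: Y_def sum_proj_std_basis[OF U])
      show "(norm (Y k))\<^sup>2 \<le> 1 / 4" for k
      proof -
        have "(norm (Y k))\<^sup>2 \<le> M * (R / ?D) / V"
          using V 2 by (intro order_trans[OF normY] divide_right_mono mult_right_mono M) auto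
        also have "\<dots> = coh_vec v / ?m" using 2 v(1) by (simp add: V_def M(3) power2_eq_square mult_ac)
        also have "\<dots> \<le> 1 / 4"
        proof -
          have "0 \<le> coh_vec v" using M by simp
          then have "4 * coh_vec v * 1 \<le> 4 * coh_vec v * ?L" using L by (intro mult_left_mono) auto
          then show ?thesis using m by (simp add: field_simps)
        qed
        finally show ?thesis .
      qed
      have "(\<Sum>k\<in>UNIV. (norm (Y k))\<^sup>2) \<le> (\<Sum>k\<in>UNIV. (v $ k)\<^sup>2 * (R / ?D) / V)"
        by (intro sum_mono normY)
      also have "\<dots> = (norm v)\<^sup>2 * (R / ?D) / V"
        by (simp add: norm_vec_sum sum_distrib_right sum_divide_distrib)
      also have "\<dots> = ?D / ?m" using 2 v(1) by (simp add: V_def power2_eq_square)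
      finally show "(\<Sum>k\<in>UNIV. (norm (Y k))\<^sup>2) \<le> ?D / ?m" by simp
    qed
    also have "\<dots> = exp (- (2 * ?L - 7 / 6))" by simp
    \<comment> \<open>2 L - 7/6 \<ge> L.\<close>
    also have "\<dots> \<le> \<delta>" using L \<delta> by (intro exp_minus_ln_inverse) auto
    finally have p: "measure_pmf.prob (pmf_of_set (UNIV :: ('m \<Rightarrow> 'd) set))
      {\<Omega>. 1 + 2 * ?L \<le> norm (\<Sum>j\<in>UNIV. Y (\<Omega> j))} \<le> \<delta>" .
    have sub: "{\<Omega>. ?\<beta> * ?V < (norm (?Z \<Omega>))\<^sup>2} \<subseteq> {\<Omega>. 1 + 2 * ?L \<le> norm (\<Sum>j\<in>UNIV. Y (\<Omega> j))}"
    proof safe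
      fix \<Omega> :: "'m \<Rightarrow> 'd" assume "?\<beta> * ?V < (norm (?Z \<Omega>))\<^sup>2"
      then have "((1 + 2 * ?L) * sqrt V)\<^sup>2 \<le> (norm (?Z \<Omega>))\<^sup>2"
        using V by (simp add: power_mult_distrib V_def R_def)
      then have "(1 + 2 * ?L) * sqrt V \<le> norm (?Z \<Omega>)" by (rule power2_le_imp_le) simp
      then show "1 + 2 * ?L \<le> norm (\<Sum>j\<in>UNIV. Y (\<Omega> j))"
        unfolding Y_def sumY using V by (simp add: pos_le_divide_eq)
    qed
    show ?thesis by (rule order_trans[OF measure_pmf.finite_measure_mono[OF sub] p]) simp
  qed
qed

lemma prob_restr_small:
  fixes U :: "(real^'d::finite) set"
  assumes U: "subspace U" and \<delta>: "0 < \<delta>" "\<delta> < 1"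
  defines "R \<equiv> real (dim U) * coh_subspace U"
  defines "\<gamma> \<equiv> sqrt (8 * R / (3 * real CARD('m::finite)) * ln (2 * real CARD('d) / \<delta>))"
  assumes \<gamma>1: "\<gamma> < 1"
  shows "measure_pmf.prob (pmf_of_set (UNIV :: ('m \<Rightarrow> 'd) set))
      {\<Omega>. \<exists>u\<in>U. (norm (restr \<Omega> u))\<^sup>2 < (1 - \<gamma>) * real CARD('m) / real CARD('d) * (norm u)\<^sup>2} \<le> \<delta>"
proof -
  let ?D = "real CARD('d)" and ?m = "real CARD('m)" and ?L = "ln (2 * real CARD('d) / \<delta>)"
  let ?a = "\<lambda>k. proj_onto U (std_basis k)"
  have a_le: "?D * (norm (?a k))\<^sup>2 \<le> R" for k
    unfolding R_def by (rule norm_proj_std_basis_le[OF U])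
  have proj_id: "proj_onto U u = u" if "u \<in> U" for u
    using that by (intro proj_onto_eqI U) auto
  have "0 \<le> ?D * (norm (?a undefined))\<^sup>2" by simp
  also have "\<dots> \<le> R" by (rule a_le)
  finally have "0 \<le> R" .
  then consider "R = 0" | "0 < R" by linarith
  then show ?thesis
  proof cases
    case 1
    \<comment> \<open>Here \<open>U\<close> is trivial, and the strict inequality fails at u =
      0.\<close>
    then have "?a k = 0" for k using a_le[of k] by (simp add: mult_le_0_iff)
    then have "u = 0" if "u \<in> U" for u
      using sum_proj_std_basis[OF U, of u] proj_id[OF that] by simp
    then have "{\<Omega> :: 'm \<Rightarrow> 'd. \<exists>u\<in>U. (norm (restr \<Omega> u))\<^sup>2 < (1 - \<gamma>) * ?m / ?D * (norm u)\<^sup>2} = {}"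
      by fastforce
    then show ?thesis using \<delta> by simp
  next
    case 2
    \<comment> \<open>The factor sqrt d gives frame constant d and bounds the squared norms by
      \<open>R\<close>.\<close>
    define b where "b = (\<lambda>k. sqrt ?D *\<^sub>R ?a k)"
    have b_inner: "(b k \<bullet> u)\<^sup>2 = ?D * (u $ k)\<^sup>2" if "u \<in> U" for u k
      by (simp add: b_def inner_proj_std_basis[OF U that] power_mult_distrib)
    interpret tight_frame U b R
    proof
      show "b k \<in> U" for k unfolding b_def by (intro subspace_scale proj_onto_in U)
      show "(norm (b k))\<^sup>2 \<le> R" for k using a_le[of k] by (simp add: b_def power_mult_distrib)
      fix w assume w: "w \<in> U"
      have "(\<Sum>k\<in>UNIV. (b k \<bullet> w) *\<^sub>R b k) = (\<Sum>k\<in>UNIV. ?D *\<^sub>R w $ k *\<^sub>R ?a k)"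
      proof (intro sum.cong refl)
        fix k :: 'd
        have "(b k \<bullet> w) *\<^sub>R b k = (sqrt ?D * sqrt ?D * w $ k) *\<^sub>R ?a k"
          by (simp only: b_def inner_scaleR_left inner_proj_std_basis[OF U w] scaleR_scaleR mult_ac)
        then show "(b k \<bullet> w) *\<^sub>R b k = ?D *\<^sub>R w $ k *\<^sub>R ?a k" by simp
      qed
      also have "\<dots> = ?D *\<^sub>R w"
        by (simp only: scaleR_sum_right[symmetric] sum_proj_std_basis[OF U] proj_id[OF w])
      finally show "(\<Sum>k\<in>UNIV. (b k \<bullet> w) *\<^sub>R b k) = ?D *\<^sub>R w" .
    qed (rule U)
    have D1: "1 \<le> ?D" by (simp add: Suc_le_eq)
    have "\<delta> < 2 * ?D" using \<delta> D1 by linarith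
    then have "1 < 2 * ?D / \<delta>" using \<delta>(1) by (simp add: pos_less_divide_eq)
    then have L: "0 < ?L" by simp
    then have \<gamma>0: "0 < \<gamma>" using 2 by (simp add: \<gamma>_def)
    have \<gamma>2: "\<gamma>\<^sup>2 = 8 * R / (3 * ?m) * ?L" using 2 L by (simp add: \<gamma>_def)
    have "measure_pmf.prob (pmf_of_set (UNIV :: ('m \<Rightarrow> 'd) set))
        {\<Omega>. \<exists>u\<in>U. norm u = 1 \<and> (\<Sum>j\<in>UNIV. (b (\<Omega> j) \<bullet> u)\<^sup>2) \<le> (1 - \<gamma>) * ?m}
      \<le> ?D * exp (- \<gamma>\<^sup>2 * ?m / (2 * R))"
      using prob_frame_le[OF 2 \<gamma>0 \<gamma>1] by simp
    \<comment> \<open>By the choice of \<gamma> the exponent is 4/3 of the logarithm; a single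
      logarithm already cancels the dimension factor and leaves \<delta>/2.\<close>
    also have "- \<gamma>\<^sup>2 * ?m / (2 * R) = - (4 / 3 * ?L)" using 2 by (simp add: \<gamma>2)
    also have "?D * exp (- (4 / 3 * ?L)) \<le> ?D * exp (- ?L)" using L by (intro mult_left_mono) auto
    also have "\<dots> = \<delta> / 2" using \<delta> by (simp add: exp_minus)
    also have "\<dots> \<le> \<delta>" using \<delta> by simp
    finally have p: "measure_pmf.prob (pmf_of_set (UNIV :: ('m \<Rightarrow> 'd) set))
        {\<Omega>. \<exists>u\<in>U. norm u = 1 \<and> (\<Sum>j\<in>UNIV. (b (\<Omega> j) \<bullet> u)\<^sup>2) \<le> (1 - \<gamma>) * ?m} \<le> \<delta>" .
    have sub: "{\<Omega>. \<exists>u\<in>U. (norm (restr \<Omega> u))\<^sup>2 < (1 - \<gamma>) * ?m / ?D * (norm u)\<^sup>2}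
      \<subseteq> {\<Omega> :: 'm \<Rightarrow> 'd. \<exists>u\<in>U. norm u = 1 \<and> (\<Sum>j\<in>UNIV. (b (\<Omega> j) \<bullet> u)\<^sup>2) \<le> (1 - \<gamma>) * ?m}"
    proof safe
      fix \<Omega> :: "'m \<Rightarrow> 'd" and u
      assume u: "u \<in> U" "(norm (restr \<Omega> u))\<^sup>2 < (1 - \<gamma>) * ?m / ?D * (norm u)\<^sup>2"
      \<comment> \<open>The strict inequality excludes u = 0, so \<open>u\<close> can be
        normalised.\<close>
      then have u0: "0 < norm u" by (auto simp: linear_0[OF linear_restr])
      define w where "w = u /\<^sub>R norm u"
      have w: "w \<in> U" "norm w = 1" using u u0 U by (simp_all add: w_def subspace_scale)
      have "restr \<Omega> w = restr \<Omega> u /\<^sub>R norm u" by (simp add: w_def linear_cmul[OF linear_restr])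
      then have "norm (restr \<Omega> w) = norm (restr \<Omega> u) / norm u" by (simp add: divide_inverse mult.commute)
      then have "(\<Sum>j\<in>UNIV. (b (\<Omega> j) \<bullet> w)\<^sup>2) = ?D * ((norm (restr \<Omega> u))\<^sup>2 / (norm u)\<^sup>2)"
        by (simp only: b_inner[OF w(1)] norm_restr[symmetric] sum_distrib_left[symmetric] power_divide)
      also have "\<dots> \<le> ?D * ((1 - \<gamma>) * ?m / ?D)"
        using u(2) u0 by (intro mult_left_mono) (auto simp: pos_divide_le_eq)
      finally show "\<exists>u\<in>U. norm u = 1 \<and> (\<Sum>j\<in>UNIV. (b (\<Omega> j) \<bullet> u)\<^sup>2) \<le> (1 - \<gamma>) * ?m"
        using w by auto
    qed
    show ?thesis by (rule order_trans[OF measure_pmf.finite_measure_mono[OF sub] p]) simp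
  qed
qed

theorem theorem4:
  fixes U :: "(real^'d::finite) set" and x v :: "real^'d"
    and \<delta> :: real and r :: nat
  assumes "subspace U" and "dim U = r"
    and "x \<in> U" and "v \<noteq> 0" and "\<forall>u\<in>U. v \<bullet> u = 0"
    and "0 < \<delta>" and "\<delta> < 1"
    and "real CARD('m::finite) \<ge> 8/3 * r * coh_subspace U * ln (2 * CARD('d) / \<delta>)"
    and "real CARD('m) \<ge> 4 * coh_vec v * ln (1 / \<delta>)"
    and "sqrt (8 * r * coh_subspace U / (3 * CARD('m)) * ln (2 * CARD('d) / \<delta>)) < 1"
  shows
    "let y = x + v; m = real CARD('m); d = real CARD('d);
         \<alpha> = sqrt (2 * coh_vec v / m * ln (1 / \<delta>)) + 2 * coh_vec v / (3 * m) * ln (1 / \<delta>);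
         \<beta> = (1 + 2 * ln (1 / \<delta>))\<^sup>2;
         \<gamma> = sqrt (8 * r * coh_subspace U / (3 * m) * ln (2 * d / \<delta>))
     in measure_pmf.prob (pmf_of_set (UNIV :: ('m \<Rightarrow> 'd) set))
          {\<Omega>. (m * (1 - \<alpha>) - r * coh_subspace U * \<beta> / (1 - \<gamma>)) / d * (norm v)\<^sup>2
                 \<le> (norm (restr \<Omega> y - proj_onto (restr_subspace \<Omega> U) (restr \<Omega> y)))\<^sup>2
              \<and> (norm (restr \<Omega> y - proj_onto (restr_subspace \<Omega> U) (restr \<Omega> y)))\<^sup>2
                 \<le> (1 + \<alpha>) * m / d * (norm v)\<^sup>2}
        \<ge> 1 - 4 * \<delta>"
proof (cases "\<delta> < 1 / 4")
  case False
  then have "1 - 4 * \<delta> \<le> measure_pmf.prob p S" for p and S :: "('m \<Rightarrow> 'd) set"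
    by (intro order_trans[OF _ measure_nonneg]) simp
  then show ?thesis unfolding Let_def .
next
  case True
  define m d where "m = real CARD('m)" and "d = real CARD('d)"
  define \<alpha> where "\<alpha> = sqrt (2 * coh_vec v / m * ln (1 / \<delta>)) + 2 * coh_vec v / (3 * m) * ln (1 / \<delta>)"
  define \<beta> where "\<beta> = (1 + 2 * ln (1 / \<delta>))\<^sup>2"
  define R where "R = r * coh_subspace U"
  define \<gamma> where "\<gamma> = sqrt (8 * R / (3 * m) * ln (2 * d / \<delta>))"
  \<comment> \<open>The spectral lower bound (1 - \<gamma>) m for the scaled frame, divided by d to
    undo the scaling.\<close>
  define \<kappa> where "\<kappa> = (1 - \<gamma>) * m / d"
  define Z where "Z = (\<lambda>\<Omega> :: 'm \<Rightarrow> 'd. \<Sum>j\<in>UNIV. v $ \<Omega> j *\<^sub>R proj_onto U (std_basis (\<Omega> j)))"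
  define e where "e = (\<lambda>\<Omega> :: 'm \<Rightarrow> 'd.
    (norm (restr \<Omega> (x + v) - proj_onto (restr_subspace \<Omega> U) (restr \<Omega> (x + v))))\<^sup>2)"
  have pos: "0 < m" "0 < d" by (simp_all add: m_def d_def)
  have \<gamma>1: "\<gamma> < 1" using assms(10) by (simp add: \<gamma>_def R_def m_def d_def mult.assoc)
  then have \<kappa>: "0 < \<kappa>" using pos by (simp add: \<kappa>_def)
  \<comment> \<open>The deterministic part: outside the four bad events both inequalities hold.
    Dividing m R |v|^2 / d^2 by \<open>\<kappa>\<close> cancels m and one factor d, which yields the
    correction term of the lower bound.\<close>
  have good: "(m * (1 - \<alpha>) - R * \<beta> / (1 - \<gamma>)) / d * (norm v)\<^sup>2 \<le> e \<Omega> \<and> e \<Omega> \<le> (1 + \<alpha>) * m / d * (norm v)\<^sup>2"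
    if up: "(norm (restr \<Omega> v))\<^sup>2 < (1 + \<alpha>) * m / d * (norm v)\<^sup>2"
      and low: "(1 - \<alpha>) * m / d * (norm v)\<^sup>2 < (norm (restr \<Omega> v))\<^sup>2"
      and Z: "(norm (Z \<Omega>))\<^sup>2 \<le> \<beta> * (m * R * (norm v)\<^sup>2 / d\<^sup>2)"
      and inj: "\<And>u. u \<in> U \<Longrightarrow> \<kappa> * (norm u)\<^sup>2 \<le> (norm (restr \<Omega> u))\<^sup>2" for \<Omega>
  proof -
    let ?W = "restr_subspace \<Omega> U"
    have W: "subspace ?W" using assms(1) by (rule subspace_restr_subspace)
    have "restr \<Omega> x \<in> ?W" using assms(3) by (simp add: restr_subspace_def)
    then have e: "e \<Omega> = (norm (restr \<Omega> v))\<^sup>2 - (norm (proj_onto ?W (restr \<Omega> v)))\<^sup>2"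
      by (simp add: e_def linear_add[OF linear_restr] proj_onto_add_left[OF W] norm_proj_onto(1)[OF W])
    have "(norm (proj_onto ?W (restr \<Omega> v)))\<^sup>2 \<le> (norm (Z \<Omega>))\<^sup>2 / \<kappa>"
      unfolding Z_def by (rule norm_proj_restr_le[OF assms(1) \<kappa> inj])
    also have "\<dots> \<le> \<beta> * (m * R * (norm v)\<^sup>2 / d\<^sup>2) / \<kappa>"
      using Z \<kappa> by (intro divide_right_mono) auto
    also have "\<dots> = R * \<beta> / (1 - \<gamma>) / d * (norm v)\<^sup>2"
      using pos \<gamma>1 by (simp add: \<kappa>_def field_simps power2_eq_square)
    finally have "(norm (proj_onto ?W (restr \<Omega> v)))\<^sup>2 \<le> R * \<beta> / (1 - \<gamma>) / d * (norm v)\<^sup>2" .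
    moreover have "(m * (1 - \<alpha>) - R * \<beta> / (1 - \<gamma>)) / d * (norm v)\<^sup>2
        = (1 - \<alpha>) * m / d * (norm v)\<^sup>2 - R * \<beta> / (1 - \<gamma>) / d * (norm v)\<^sup>2"
      by (simp only: diff_divide_distrib left_diff_distrib mult.commute[of m])
    moreover have "0 \<le> (norm (proj_onto ?W (restr \<Omega> v)))\<^sup>2" by simp
    ultimately show ?thesis using up low unfolding e by linarith
  qed
  have "1 - 4 * \<delta> \<le> measure_pmf.prob (pmf_of_set (UNIV :: ('m \<Rightarrow> 'd) set))
      {\<Omega>. (m * (1 - \<alpha>) - R * \<beta> / (1 - \<gamma>)) / d * (norm v)\<^sup>2 \<le> e \<Omega> \<and> e \<Omega> \<le> (1 + \<alpha>) * m / d * (norm v)\<^sup>2}"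
  proof (rule prob_ge_compl_four)
    show "- {\<Omega>. (m * (1 - \<alpha>) - R * \<beta> / (1 - \<gamma>)) / d * (norm v)\<^sup>2 \<le> e \<Omega> \<and> e \<Omega> \<le> (1 + \<alpha>) * m / d * (norm v)\<^sup>2}
      \<subseteq> {\<Omega>. (1 + \<alpha>) * m / d * (norm v)\<^sup>2 \<le> (norm (restr \<Omega> v))\<^sup>2}
        \<union> {\<Omega>. (norm (restr \<Omega> v))\<^sup>2 \<le> (1 - \<alpha>) * m / d * (norm v)\<^sup>2}
        \<union> {\<Omega>. \<beta> * (m * R * (norm v)\<^sup>2 / d\<^sup>2) < (norm (Z \<Omega>))\<^sup>2}
        \<union> {\<Omega>. \<exists>u\<in>U. (norm (restr \<Omega> u))\<^sup>2 < \<kappa> * (norm u)\<^sup>2}"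
      using good by (force simp: not_le not_less)
    show "measure_pmf.prob (pmf_of_set (UNIV :: ('m \<Rightarrow> 'd) set))
        {\<Omega>. (1 + \<alpha>) * m / d * (norm v)\<^sup>2 \<le> (norm (restr \<Omega> v))\<^sup>2} \<le> \<delta>"
      and "measure_pmf.prob (pmf_of_set (UNIV :: ('m \<Rightarrow> 'd) set))
        {\<Omega>. (norm (restr \<Omega> v))\<^sup>2 \<le> (1 - \<alpha>) * m / d * (norm v)\<^sup>2} \<le> \<delta>"
      using prob_norm_restr_ge[OF assms(4,6,7), where 'm = 'm] unfolding \<alpha>_def m_def d_def by simp_all
    show "measure_pmf.prob (pmf_of_set (UNIV :: ('m \<Rightarrow> 'd) set))
        {\<Omega>. \<beta> * (m * R * (norm v)\<^sup>2 / d\<^sup>2) < (norm (Z \<Omega>))\<^sup>2} \<le> \<delta>"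
      using prob_norm_sum_proj_gt[OF assms(1,4) _ assms(6) True assms(9)] assms(5)
      unfolding \<beta>_def m_def d_def R_def Z_def assms(2) by simp
    show "measure_pmf.prob (pmf_of_set (UNIV :: ('m \<Rightarrow> 'd) set))
        {\<Omega>. \<exists>u\<in>U. (norm (restr \<Omega> u))\<^sup>2 < \<kappa> * (norm u)\<^sup>2} \<le> \<delta>"
      using prob_restr_small[OF assms(1,6,7), where 'm = 'm] \<gamma>1
      unfolding \<kappa>_def \<gamma>_def m_def d_def R_def assms(2) by simp
  qed
  then show ?thesis
    unfolding Let_def e_def R_def \<alpha>_def \<beta>_def \<gamma>_def m_def d_def by (simp add: mult.assoc)
qed

end
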